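(* Let $X$ be a separable rearrangement-invariant Banach function space on $\mathbb{T}$. Then the set of analytic polynomials $\mathcal{P}_A$ is dense in the abstract Hardy space $H[X]$ (with respect to the norm of $X$). Moreover, for every $f\in H[X]$, there is a sequence of analytic polynomials $\{p_n\}$ such that $\|p_n\|_X\le\|f\|_X$ for all $n\in\mathbb{N}$ and $p_n\to f$ in the norm of $X$ as $n\to\infty$.
   Context: $\mathbb{T}=\{z\in\mathbb{C}:|z|=1\}$ is equipped with the normalized Lebesgue measure $dm(t)=|dt|/(2\pi)$. $L^0$ is the space of all measurable complex-valued functions on $\mathbb{T}$ (functions equal a.e. are identified), $L^0_+$ is the set of measurable functions on $\mathbb{T}$ with values in $[0,\infty]$, $L^1=L^1(\mathbb{T})$, and $\chi_E$ is the characteristic function of $E$. A mapping $\rho:L^0_+\to[0,\infty]$ is called a Banach function norm if for all $f,g,f_n\in L^0_+$ ($n\in\mathbb{N}$), all constants $a\ge 0$ and all measurable $E\subset\mathbb{T}$: (A1) $\rho(f)=0\Leftrightarrow f=0$ a.e., $\rho(af)=a\rho(f)$, $\rho(f+g)\le\rho(f)+\rho(g)$; (A2) $0\le g\le f$ a.e. $\Rightarrow\rho(g)\le\rho(f)$; (A3) $0\le f_n\uparrow f$ a.e. $\Rightarrow\rho(f_n)\uparrow\rho(f)$; (A4) $m(E)<\infty\Rightarrow\rho(\chi_E)<\infty$; (A5) $\int_E f\,dm\le C_E\,\rho(f)$ with a constant $C_E\in(0,\infty)$ that may depend on $E$ and $\rho$ but not on $f$. The set $X$ of all $f\in L^0$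 with $\rho(|f|)<\infty$, with norm $\|f\|_X:=\rho(|f|)$, is called a Banach function space on $\mathbb{T}$; it is a Banach space. The distribution function of an a.e. finite $f\in L^0$ is $m_f(\lambda):=m\{t\in\mathbb{T}:|f(t)|>\lambda\}$, $\lambda\ge0$. Two a.e. finite functions $f,g\in L^0$ are equimeasurable if $m_f(\lambda)=m_g(\lambda)$ for all $\lambda\ge 0$. A Banach function space $X$ is rearrangement-invariant if for every pair of a.e. finite equimeasurable functions $f,g\in L^0$: if $f\in X$, then $g\in X$ and $\|f\|_X=\|g\|_X$. For $f\in L^1$, $\widehat f(n):=\frac1{2\pi}\int_{-\pi}^{\pi}f(e^{i\varphi})e^{-in\varphi}\,d\varphi$, $n\in\mathbb{Z}$. The abstract Hardy space built upon $X$ is $H[X]:=\{f\in X:\widehat f(n)=0\text{ for all }n<0\}$. $\mathcal{P}_A$ is the set of analytic polynomials, i.e. functions $q(t)=\sum_{k=0}^n\alpha_kt^k$, $t\in\mathbb{T}$, with $\alpha_0,\dots,\alpha_n\in\mathbb{C}$. *)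

theory Defs
  imports "HOL-Analysis.Analysis"
begin

text \<open>
  Elements of \<open>L\<^sup>0\<close> are represented by functions on the whole complex plane; only their
  values on the unit circle matter. Functions that are equal a.e. are not literally identified:
  all notions below are invariant under changing a function on a null set, so \<open>X\<close> is treated as
  a seminormed space whose null vectors are the functions vanishing a.e.
\<close>

text \<open>
  Normalized arc length, as the image of the uniform distribution on \<open>[-\<pi>, \<pi>]\<close>. The
  completion makes its measurable sets the Lebesgue (not only the Borel) subsets of the circle.
\<close>

definition circle :: "complex measure" where
  "circle = completion (distr (uniform_measure lborel {-pi..pi})
                              (restrict_space borel (sphere 0 1)) cis)"

abbreviation L0 :: "(complex \<Rightarrow> complex) set" where
  "L0 \<equiv> borel_measurable circle"

abbreviation L0_plus :: "(complex \<Rightarrow> ennreal) set" where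
  "L0_plus \<equiv> borel_measurable circle"

definition banach_function_norm :: "((complex \<Rightarrow> ennreal) \<Rightarrow> ennreal) \<Rightarrow> bool" where
  "banach_function_norm \<rho> \<longleftrightarrow>
     (\<forall>f\<in>L0_plus. \<rho> f = 0 \<longleftrightarrow> (AE t in circle. f t = 0)) \<and>
     (\<forall>f\<in>L0_plus. \<forall>a::real. a \<ge> 0 \<longrightarrow> \<rho> (\<lambda>t. ennreal a * f t) = ennreal a * \<rho> f) \<and>
     (\<forall>f\<in>L0_plus. \<forall>g\<in>L0_plus. \<rho> (\<lambda>t. f t + g t) \<le> \<rho> f + \<rho> g) \<and>
     (\<forall>f\<in>L0_plus. \<forall>g\<in>L0_plus. (AE t in circle. g t \<le> f t) \<longrightarrow> \<rho> g \<le> \<rho> f) \<and>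
     (\<forall>f\<in>L0_plus. \<forall>F :: nat \<Rightarrow> complex \<Rightarrow> ennreal. (\<forall>n. F n \<in> L0_plus) \<longrightarrow>
        (AE t in circle. incseq (\<lambda>n. F n t) \<and> (\<lambda>n. F n t) \<longlonglongrightarrow> f t) \<longrightarrow>
        incseq (\<lambda>n. \<rho> (F n)) \<and> (\<lambda>n. \<rho> (F n)) \<longlonglongrightarrow> \<rho> f) \<and>
     (\<forall>E\<in>sets circle. emeasure circle E < \<infinity> \<longrightarrow> \<rho> (indicator E) < \<infinity>) \<and>
     (\<forall>E\<in>sets circle. \<exists>C::real. C > 0 \<and>
        (\<forall>f\<in>L0_plus. (\<integral>\<^sup>+t\<in>E. f t \<partial>circle) \<le> ennreal C * \<rho> f))"

definition bfs :: "((complex \<Rightarrow> ennreal) \<Rightarrow> ennreal) \<Rightarrow> (complex \<Rightarrow> complex) set" where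
  "bfs \<rho> = {f \<in> L0. \<rho> (\<lambda>t. ennreal (norm (f t))) < \<infinity>}"

definition bfs_norm :: "((complex \<Rightarrow> ennreal) \<Rightarrow> ennreal) \<Rightarrow> (complex \<Rightarrow> complex) \<Rightarrow> real" where
  "bfs_norm \<rho> f = enn2real (\<rho> (\<lambda>t. ennreal (norm (f t))))"

definition bfs_dense_in ::
  "((complex \<Rightarrow> ennreal) \<Rightarrow> ennreal) \<Rightarrow> (complex \<Rightarrow> complex) set \<Rightarrow> (complex \<Rightarrow> complex) set \<Rightarrow> bool"
where
  "bfs_dense_in \<rho> D S \<longleftrightarrow>
     D \<subseteq> S \<and> (\<forall>f\<in>S. \<forall>\<epsilon>>0. \<exists>g\<in>D. bfs_norm \<rho> (\<lambda>t. f t - g t) < \<epsilon>)"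

definition bfs_separable :: "((complex \<Rightarrow> ennreal) \<Rightarrow> ennreal) \<Rightarrow> bool" where
  "bfs_separable \<rho> \<longleftrightarrow> (\<exists>D. countable D \<and> bfs_dense_in \<rho> D (bfs \<rho>))"

definition distribution_function :: "(complex \<Rightarrow> complex) \<Rightarrow> real \<Rightarrow> real" where
  "distribution_function f l = measure circle {t \<in> space circle. norm (f t) > l}"

definition equimeasurable :: "(complex \<Rightarrow> complex) \<Rightarrow> (complex \<Rightarrow> complex) \<Rightarrow> bool" where
  "equimeasurable f g \<longleftrightarrow>
     (\<forall>l\<ge>0. distribution_function f l = distribution_function g l)"

text \<open>Complex-valued functions are finite everywhere, so a.e. finiteness need not be required.\<close>

definition rearrangement_invariant :: "((complex \<Rightarrow> ennreal) \<Rightarrow> ennreal) \<Rightarrow> bool" where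
  "rearrangement_invariant \<rho> \<longleftrightarrow>
     (\<forall>f\<in>L0. \<forall>g\<in>L0. equimeasurable f g \<longrightarrow> f \<in> bfs \<rho> \<longrightarrow>
        g \<in> bfs \<rho> \<and> bfs_norm \<rho> f = bfs_norm \<rho> g)"

definition fourier_coeff :: "(complex \<Rightarrow> complex) \<Rightarrow> int \<Rightarrow> complex" where
  "fourier_coeff f n =
     1 / (2 * of_real pi) *
     (LINT \<phi>:{-pi..pi}|lebesgue. f (cis \<phi>) * exp (- \<i> * of_int n * of_real \<phi>))"

definition hardy :: "((complex \<Rightarrow> ennreal) \<Rightarrow> ennreal) \<Rightarrow> (complex \<Rightarrow> complex) set" where
  "hardy \<rho> = {f \<in> bfs \<rho>. \<forall>n<0. fourier_coeff f n = 0}"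

definition analytic_polynomials :: "(complex \<Rightarrow> complex) set" where
  "analytic_polynomials = {q. \<exists>(n::nat) (\<alpha> :: nat \<Rightarrow> complex). q = (\<lambda>t. \<Sum>k\<le>n. \<alpha> k * t ^ k)}"

end

theory Submission
  imports Defs
begin

text \<open>
  Separability makes the norm absolutely continuous, so a dominated convergence theorem holds in
  \<open>X\<close> and trigonometric polynomials are dense in \<open>X\<close>. For a trigonometric polynomial \<open>q\<close> the
  Fejer mean is exactly a convex combination of finitely many rotations of \<open>q\<close> (sample the
  convolution with the nonnegative Fejer kernel at roots of unity), and rotations are isometries
  of a rearrangement-invariant space; hence \<open>\<parallel>\<sigma>\<^sub>n q\<parallel> \<le> \<parallel>q\<parallel>\<close>. As \<open>\<sigma>\<^sub>n\<close> depends on finitely many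
  Fourier coefficients, each continuous on \<open>X\<close>, the bound and the convergence \<open>\<sigma>\<^sub>n f \<rightarrow> f\<close> extend to
  all of \<open>X\<close> by density. The Fejer means of a function in the Hardy space are analytic polynomials.
\<close>

section \<open>The circle measure\<close>

text \<open>The usual bound for a convolution with the Fejer kernel is Minkowski's inequality for
  integrals, which in X calls for vector-valued integration or duality. Sampling replaces it by the
  triangle inequality for a finite sum, but it is exact only on trigonometric polynomials. This is
  why contractivity is obtained there and extended by density. For the extension, each fixed n needs
  only some bound for the n-th mean on X, however it grows with n; the embedding of X into L^1
  contained in (A5) supplies one. Rotations therefore act on continuous functions only, so that
  equimeasurability is a matter of Borel sets. Absolute continuity of the norm is the essential gain
  from separability: in L^\<infinity>, bounded pointwise convergence does not give norm convergence,
  and the trigonometric polynomials are not dense.\<close>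

definition circle0 :: "complex measure" where
  "circle0 = distr (uniform_measure lborel {-pi..pi}) (restrict_space borel (sphere 0 1)) cis"

lemma cis_measurable_sphere [measurable]: "cis \<in> borel \<rightarrow>\<^sub>M restrict_space borel (sphere 0 1)"
  by (rule measurable_restrict_space2) (auto intro!: borel_measurable_continuous_onI continuous_intros)

text \<open>Change of variables and rotation invariance are arguments about Borel sets, so they are
  carried out for \<open>circle0\<close> and transferred to the completion up to null sets.\<close>

lemma circle_eq_completion: "circle = completion circle0"
  by (simp add: circle_def circle0_def)

lemma space_circle0 [simp]: "space circle0 = sphere 0 1"
  by (simp add: circle0_def space_restrict_space)

lemma space_circle [simp]: "space circle = sphere 0 1"
  by (simp add: circle_eq_completion)

lemma sets_circle0 [measurable_cong]: "sets circle0 = sets (restrict_space borel (sphere 0 1))"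
  by (simp add: circle0_def)

lemma emeasure_circle0:
  assumes "A \<in> sets circle0"
  shows "emeasure circle0 A = emeasure lborel ({-pi..pi} \<inter> cis -` A) / ennreal (2 * pi)"
proof -
  have m: "cis \<in> uniform_measure lborel {-pi..pi} \<rightarrow>\<^sub>M restrict_space borel (sphere 0 1)"
    by measurable
  have b: "cis -` A \<in> sets borel"
    using measurable_sets[OF cis_measurable_sphere, of A] assms by (simp add: sets_circle0)
  show ?thesis
    using assms b unfolding circle0_def
    by (subst emeasure_distr[OF m]) (auto simp: ennreal_plus[symmetric] simp del: ennreal_plus)
qed

lemma emeasure_space_circle0: "emeasure circle0 (space circle0) = 1"
proof -
  have "cis -` sphere 0 1 = UNIV" by auto
  then show ?thesis
    by (subst emeasure_circle0)
      (auto simp: sets.top[of circle0, simplified] ennreal_plus[symmetric] divide_ennreal[symmetric] simp del: ennreal_plus)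
qed

interpretation circle: finite_measure circle
  using emeasure_space_circle0 sets.top[of circle0]
  by (intro finite_measureI) (simp add: circle_eq_completion del: sets.top)

interpretation circle: complete_measure circle
  unfolding circle_eq_completion by (rule completion.complete_measure_axioms)

lemma borel_measurable_circle0I:
  "f \<in> borel_measurable (restrict_space borel (sphere 0 1)) \<Longrightarrow> f \<in> borel_measurable circle0"
  by (simp add: measurable_cong_sets[OF sets_circle0])

lemma continuous_measurable_circle0:
  fixes f :: "complex \<Rightarrow> 'a::topological_space"
  assumes "continuous_on (sphere 0 1) f"
  shows "f \<in> borel_measurable circle0"
  by (intro borel_measurable_circle0I borel_measurable_continuous_on_restrict assms)

lemma continuous_L0:
  fixes f :: "complex \<Rightarrow> 'a::topological_space"
  assumes "continuous_on (sphere 0 1) f"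
  shows "f \<in> borel_measurable circle"
  using continuous_measurable_circle0[OF assms] by (simp add: circle_eq_completion measurable_completion)

text \<open>The preimages of a Borel set under \<open>f\<close> and \<open>g\<close> differ by a
  subset of a null set, and completeness makes such subsets measurable.\<close>

lemma (in complete_measure) borel_measurable_AE_cong:
  assumes g: "g \<in> M \<rightarrow>\<^sub>M borel" and eq: "AE x in M. f x = g x"
  shows "f \<in> M \<rightarrow>\<^sub>M borel"
proof (rule measurableI)
  fix A :: "'b set" assume A: "A \<in> sets borel"
  show "f -` A \<inter> space M \<in> sets M"
  proof (rule in_sets_AE)
    show "g -` A \<inter> space M \<in> sets M" using g A by (rule measurable_sets)
    show "AE x in M. (x \<in> g -` A \<inter> space M) = (x \<in> f -` A \<inter> space M)"
      using eq by eventually_elim auto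
  qed auto
qed auto

lemma completion_ex_borel_measurable_complex:
  fixes f :: "'a \<Rightarrow> complex"
  assumes f: "f \<in> borel_measurable (completion M)"
  obtains f' where "f' \<in> borel_measurable M" "AE x in M. f x = f' x"
proof -
  have "(\<lambda>x. Re (f x)) \<in> borel_measurable (completion M)" "(\<lambda>x. Im (f x)) \<in> borel_measurable (completion M)"
    using f by measurable
  then obtain g h where g: "g \<in> borel_measurable M" "AE x in M. Re (f x) = g x"
    and h: "h \<in> borel_measurable M" "AE x in M. Im (f x) = h x"
    by (metis completion_ex_borel_measurable_real)
  show thesis
  proof
    show "(\<lambda>x. Complex (g x) (h x)) \<in> borel_measurable M"
      unfolding Complex_eq using g(1) h(1) by measurable
    show "AE x in M. f x = Complex (g x) (h x)"
      using g(2) h(2) by eventually_elim (simp add: complex_eq_iff)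
  qed
qed

section \<open>Integrals over the circle as integrals over an interval\<close>

lemma AE_circle0_cis:
  assumes "AE t in circle0. P t"
  shows "AE x in lborel. x \<in> {-pi..pi} \<longrightarrow> P (cis x)"
proof -
  have "AE x in uniform_measure lborel {-pi..pi}. P (cis x)"
    using assms unfolding circle0_def by (rule AE_distrD[rotated]) measurable
  then show ?thesis
    by (subst (asm) AE_uniform_measure) (auto simp: ennreal_plus[symmetric] simp del: ennreal_plus)
qed

text \<open>A function measurable for the completion cannot be pulled back along \<open>cis\<close>
  directly. It is replaced by an a.e. equal Borel function \<open>g\<close>, for which the image
  measure formula applies; null sets of the circle pull back to null sets of the interval, which
  returns the result to \<open>f\<close>. A non-integrable \<open>f\<close> is covered, both sides
  then being 0.\<close>

lemma integral_circle:
  fixes f :: "complex \<Rightarrow> complex"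
  assumes f: "f \<in> borel_measurable circle"
  shows "(LINT t|circle. f t) = 1 / (2 * of_real pi) * (LINT x:{-pi..pi}|lebesgue. f (cis x))"
proof -
  obtain g where g [measurable]: "g \<in> borel_measurable circle0" and ae: "AE t in circle0. f t = g t"
    using completion_ex_borel_measurable_complex f unfolding circle_eq_completion by metis
  have g' [measurable]: "g \<in> borel_measurable (restrict_space borel (sphere 0 1))"
    using g by (simp add: measurable_cong_sets[OF sets_circle0])
  have m: "(\<lambda>x. indicator {-pi..pi} x *\<^sub>R g (cis x)) \<in> borel_measurable lborel"
    by measurable
  have ae': "AE x in lebesgue. indicator {-pi..pi} x *\<^sub>R f (cis x) = indicator {-pi..pi} x *\<^sub>R g (cis x)"
    using AE_circle0_cis[OF ae] by (intro AE_completion) (auto simp: indicator_def elim!: eventually_mono)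
  have "(LINT t|circle. f t) = (LINT t|circle. g t)"
    using AE_completion[OF ae] f measurable_completion[OF g] unfolding circle_eq_completion
    by (intro integral_cong_AE)
  also have "\<dots> = (LINT t|circle0. g t)"
    by (simp add: circle_eq_completion integral_completion)
  also have "\<dots> = (LINT x|uniform_measure lborel {-pi..pi}. g (cis x))"
    unfolding circle0_def by (rule integral_distr) measurable
  also have "\<dots> = (LINT x|density lborel (\<lambda>x. ennreal (indicator {-pi..pi} x / (2*pi))). g (cis x))"
    unfolding uniform_measure_def
    by (intro arg_cong2[where f = "integral\<^sup>L"] arg_cong2[where f = density] ext refl)
      (auto simp: indicator_def divide_ennreal[symmetric] ennreal_plus[symmetric] simp del: ennreal_plus)
  also have "\<dots> = (LINT x|lborel. (indicator {-pi..pi} x / (2*pi)) *\<^sub>R g (cis x))"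
    by (rule integral_density) auto
  also have "\<dots> = (LINT x|lborel. (1/(2*pi)) *\<^sub>R (indicator {-pi..pi} x *\<^sub>R g (cis x)))"
    by simp
  also have "\<dots> = (1/(2*pi)) *\<^sub>R (LINT x|lborel. (indicator {-pi..pi} x *\<^sub>R g (cis x)))"
    by (rule integral_scaleR_right)
  also have "(LINT x|lborel. (indicator {-pi..pi} x *\<^sub>R g (cis x))) =
     (LINT x|lebesgue. (indicator {-pi..pi} x *\<^sub>R g (cis x)))"
    by (rule integral_completion[symmetric, OF m])
  also have "\<dots> = (LINT x|lebesgue. (indicator {-pi..pi} x *\<^sub>R f (cis x)))"
    using ae' measurable_completion[OF m]
    by (intro integral_cong_AE completion.borel_measurable_AE_cong[OF measurable_completion[OF m] ae'])
      (auto elim!: eventually_mono)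
  finally show ?thesis
    by (simp add: set_lebesgue_integral_def scaleR_conv_of_real)
qed

lemma fourier_coeff_eq_integral:
  assumes "f \<in> L0"
  shows "fourier_coeff f n = (LINT t|circle. f t * t powi (-n))"
proof -
  have e: "exp (- \<i> * of_int n * of_real x) = cis x powi (-n)" for x
    by (subst cis_power_int) (simp add: cis_conv_exp mult_ac)
  have [measurable]: "(\<lambda>t. t powi (-n)) \<in> L0"
    by (intro continuous_L0 continuous_intros) auto
  have "(\<lambda>t. f t * t powi (-n)) \<in> L0"
    using assms by measurable
  then show ?thesis
    unfolding fourier_coeff_def e by (rule integral_circle[symmetric])
qed

section \<open>Rotation invariance of arc length and orthogonality of the powers\<close>

lemma emeasure_lborel_translation:
  assumes "B \<in> sets borel"
  shows "emeasure lborel ((\<lambda>x. x + c) -` B) = emeasure lborel (B :: real set)"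
proof -
  have "emeasure lborel B = emeasure (distr lborel borel ((+) c)) B"
    by (simp add: lborel_distr_plus)
  also have "\<dots> = emeasure lborel ((\<lambda>x. x + c) -` B)"
    using assms by (subst emeasure_distr) (auto simp: add.commute[of c] vimage_def)
  finally show ?thesis ..
qed

text \<open>The shift turns the window \<open>{a..<a+p}\<close> into \<open>{a+c..<a+p+c}\<close>.
  The part that sticks out, \<open>{a+p..<a+p+c}\<close>, moves back by one period onto the missing
  part \<open>{a..<a+c}\<close>.\<close>

lemma emeasure_periodic_shift:
  fixes p :: real
  assumes B: "B \<in> sets borel" and per: "\<And>x. x + p \<in> B \<longleftrightarrow> x \<in> B" and c: "0 \<le> c" "c \<le> p"
  shows "emeasure lborel ({a..<a+p} \<inter> (\<lambda>x. x + c) -` B) = emeasure lborel ({a..<a+p} \<inter> B)"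
proof -
  have "emeasure lborel ({a..<a+p} \<inter> (\<lambda>x. x + c) -` B) = emeasure lborel ((\<lambda>x. x + c) -` ({a+c..<a+p+c} \<inter> B))"
    by (intro arg_cong2[where f=emeasure]) auto
  also have "\<dots> = emeasure lborel ({a+c..<a+p+c} \<inter> B)"
    using B by (intro emeasure_lborel_translation) auto
  also have "\<dots> = emeasure lborel (({a+c..<a+p} \<inter> B) \<union> ({a+p..<a+p+c} \<inter> B))"
    using c by (intro arg_cong2[where f=emeasure]) auto
  also have "\<dots> = emeasure lborel ({a+c..<a+p} \<inter> B) + emeasure lborel ({a+p..<a+p+c} \<inter> B)"
    using B by (intro plus_emeasure[symmetric]) auto
  also have "emeasure lborel ({a+p..<a+p+c} \<inter> B) = emeasure lborel ((\<lambda>x. x + p) -` ({a+p..<a+p+c} \<inter> B))"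
    using B by (intro emeasure_lborel_translation[symmetric]) auto
  also have "(\<lambda>x. x + p) -` ({a+p..<a+p+c} \<inter> B) = {a..<a+c} \<inter> B"
    using per by auto
  also have "emeasure lborel ({a+c..<a+p} \<inter> B) + emeasure lborel ({a..<a+c} \<inter> B) =
     emeasure lborel (({a+c..<a+p} \<inter> B) \<union> ({a..<a+c} \<inter> B))"
    using B by (intro plus_emeasure) auto
  also have "({a+c..<a+p} \<inter> B) \<union> ({a..<a+c} \<inter> B) = {a..<a+p} \<inter> B"
    using c by auto
  finally show ?thesis .
qed

lemma rotation_measurable [measurable]:
  assumes "norm s = 1" shows "(\<lambda>t. s * t) \<in> circle0 \<rightarrow>\<^sub>M circle0"
  unfolding measurable_cong_sets[OF sets_circle0 sets_circle0]
  using assms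
  by (intro measurable_restrict_space2 borel_measurable_continuous_on_restrict continuous_intros)
    (auto simp: space_restrict_space norm_mult)

text \<open>Writing \<open>s = cis c\<close> turns the rotation into a translation by
  \<open>c\<close> of the preimage of \<open>A\<close> under \<open>cis\<close>, a set of period 2
  pi.\<close>

lemma circle0_rotation:
  assumes s: "norm s = 1"
  shows "distr circle0 circle0 (\<lambda>t. s * t) = circle0"
proof (rule measure_eqI)
  obtain c where c: "0 \<le> c" "c < 2 * pi" "s = cis c"
    using that[of "Arg2pi s"] Arg2pi_eq[of s] s by (simp add: cis_conv_exp Arg2pi_ge_0 Arg2pi_lt_2pi)
  fix A assume "A \<in> sets (distr circle0 circle0 (\<lambda>t. s * t))"
  then have A: "A \<in> sets circle0" by simp
  have B: "cis -` A \<in> sets borel"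
    using measurable_sets[OF cis_measurable_sphere, of A] A by (simp add: sets_circle0)
  \<comment> \<open>\<open>circle0\<close> lives on a closed interval, the periodicity argument on a
    half-open one; they differ by the null set \<open>{pi}\<close>.\<close>
  have half: "emeasure lborel ({-pi..pi} \<inter> D) = emeasure lborel ({-pi..<-pi+2*pi} \<inter> D)" if "D \<in> sets borel" for D
    using that
    by (intro emeasure_eq_AE AE_I[of _ _ "{pi}"]) auto
  have A': "(\<lambda>t. s * t) -` A \<inter> space circle0 \<in> sets circle0"
    using rotation_measurable[OF s] A by (rule measurable_sets)
  have v: "cis -` ((\<lambda>t. s * t) -` A \<inter> space circle0) = (\<lambda>x. x + c) -` cis -` A"
    by (auto simp: c cis_mult add.commute)
  have "emeasure lborel ({-pi..pi} \<inter> (\<lambda>x. x + c) -` cis -` A) = emeasure lborel ({-pi..<-pi+2*pi} \<inter> (\<lambda>x. x + c) -` cis -` A)"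
    by (intro half measurable_sets_borel[OF _ B]) measurable
  also have "\<dots> = emeasure lborel ({-pi..<-pi+2*pi} \<inter> cis -` A)"
    using c B by (intro emeasure_periodic_shift) (auto simp: cis_mult[symmetric])
  also have "\<dots> = emeasure lborel ({-pi..pi} \<inter> cis -` A)"
    by (rule half[OF B, symmetric])
  finally show "emeasure (distr circle0 circle0 (\<lambda>t. s * t)) A = emeasure circle0 A"
    using A A' v by (simp add: emeasure_distr[OF rotation_measurable[OF s]] emeasure_circle0)
qed simp

text \<open>For \<open>k\<close> \<noteq> 0, rotation by \<open>s = cis (pi / k)\<close> multiplies
  the integrand by \<open>s powi k = -1\<close> and preserves the measure, so the integral equals
  its own negative.\<close>

lemma integral_circle_power_int:
  "(LINT t|circle. t powi k) = (if k = 0 then 1 else 0)"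
proof (cases "k = 0")
  case True
  then show ?thesis using emeasure_space_circle0 sets.top[of circle0] by (simp add: measure_def circle_eq_completion del: sets.top)
next
  case False
  define s where "s = cis (pi / of_int k)"
  have s: "norm s = 1" "s powi k = -1"
    using False by (simp_all add: s_def cis_power_int)
  have [measurable]: "(\<lambda>t. t powi k) \<in> borel_measurable circle0"
    by (intro continuous_measurable_circle0 continuous_intros) auto
  have "(LINT t|circle0. t powi k) = (LINT t|distr circle0 circle0 (\<lambda>t. s * t). t powi k)"
    by (simp add: circle0_rotation s)
  also have "\<dots> = (LINT t|circle0. (s * t) powi k)"
    by (rule integral_distr[OF rotation_measurable]) (use s in auto)
  also have "\<dots> = - (LINT t|circle0. t powi k)"
    by (simp add: power_int_mult_distrib s)
  finally show ?thesis
    using False by (simp add: circle_eq_completion integral_completion)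
qed

text \<open>The level sets of the rotated function are the preimages under the rotation of the level
  sets of \<open>g\<close>, and rotations preserve \<open>circle0\<close>.\<close>

lemma equimeasurable_rotation:
  assumes g: "g \<in> borel_measurable circle0" and s: "norm s = 1"
  shows "equimeasurable g (\<lambda>t. g (s * t))"
proof -
  have "distribution_function g l = distribution_function (\<lambda>t. g (s * t)) l" for l
  proof -
    have S: "{t \<in> space circle0. norm (g t) > l} \<in> sets circle0"
      using g by measurable
    have S': "{t \<in> space circle0. norm (g (s * t)) > l} = (\<lambda>t. s * t) -` {t \<in> space circle0. norm (g t) > l} \<inter> space circle0"
      using s by (auto simp: norm_mult)
    have "measure circle0 {t \<in> space circle0. norm (g t) > l} =
      measure (distr circle0 circle0 (\<lambda>t. s * t)) {t \<in> space circle0. norm (g t) > l}"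
      by (simp add: circle0_rotation s)
    also have "\<dots> = measure circle0 {t \<in> space circle0. norm (g (s * t)) > l}"
      unfolding S' by (rule measure_distr[OF rotation_measurable[OF s] S])
    finally show ?thesis
      using S S' measurable_sets[OF rotation_measurable[OF s] S]
      by (simp add: distribution_function_def circle_eq_completion)
  qed
  then show ?thesis by (simp add: equimeasurable_def)
qed

section \<open>Banach function norms\<close>

text \<open>Since \<open>enn2real\<close> sends \<infinity> to 0, \<open>N\<close> takes the value 0
  on functions of infinite norm. Estimates of \<open>N\<close> therefore go together with membership
  in \<open>bfs \<rho>\<close>.\<close>

locale bf_norm =
  fixes \<rho> :: "(complex \<Rightarrow> ennreal) \<Rightarrow> ennreal"
  assumes bfn: "banach_function_norm \<rho>"
begin

abbreviation N :: "(complex \<Rightarrow> complex) \<Rightarrow> real" where "N \<equiv> bfs_norm \<rho>"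

lemma rho_scale:
  "f \<in> L0_plus \<Longrightarrow> 0 \<le> a \<Longrightarrow> \<rho> (\<lambda>t. ennreal a * f t) = ennreal a * \<rho> f"
  using bfn unfolding banach_function_norm_def by blast

lemma rho_add: "f \<in> L0_plus \<Longrightarrow> g \<in> L0_plus \<Longrightarrow> \<rho> (\<lambda>t. f t + g t) \<le> \<rho> f + \<rho> g"
  using bfn unfolding banach_function_norm_def by blast

lemma rho_mono:
  "f \<in> L0_plus \<Longrightarrow> g \<in> L0_plus \<Longrightarrow> AE t in circle. g t \<le> f t \<Longrightarrow> \<rho> g \<le> \<rho> f"
  using bfn unfolding banach_function_norm_def by blast

lemma rho_incseq_tendsto:
  "f \<in> L0_plus \<Longrightarrow> (\<And>n. F n \<in> L0_plus) \<Longrightarrow>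
    AE t in circle. incseq (\<lambda>n. F n t) \<and> (\<lambda>n. F n t) \<longlonglongrightarrow> f t \<Longrightarrow> (\<lambda>n. \<rho> (F n)) \<longlonglongrightarrow> \<rho> f"
  using bfn unfolding banach_function_norm_def by blast

lemma rho_indicator_finite:
  assumes "E \<in> sets circle" shows "\<rho> (indicator E) < \<infinity>"
proof -
  have "emeasure circle E < \<infinity>"
    using circle.emeasure_finite[of E] by (simp add: less_top[symmetric])
  with assms show ?thesis
    using bfn unfolding banach_function_norm_def by blast
qed

text \<open>This is (A5) for the whole circle.\<close>

lemma rho_integral_bound:
  obtains C :: real where "C > 0" "\<And>f. f \<in> L0_plus \<Longrightarrow> (\<integral>\<^sup>+t. f t \<partial>circle) \<le> ennreal C * \<rho> f"
proof -
  have "\<forall>E\<in>sets circle. \<exists>C::real. C > 0 \<and>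
      (\<forall>f\<in>L0_plus. (\<integral>\<^sup>+t\<in>E. f t \<partial>circle) \<le> ennreal C * \<rho> f)"
    using bfn unfolding banach_function_norm_def by (elim conjE)
  from bspec[OF this sets.top] obtain C :: real where C: "C > 0"
    "\<And>f. f \<in> L0_plus \<Longrightarrow> (\<integral>\<^sup>+t\<in>space circle. f t \<partial>circle) \<le> ennreal C * \<rho> f"
    by (elim exE conjE) (simp only: Ball_def)
  have "(\<integral>\<^sup>+t\<in>space circle. f t \<partial>circle) = (\<integral>\<^sup>+t. f t \<partial>circle)" for f :: "complex \<Rightarrow> ennreal"
    by (intro nn_integral_cong) simp
  with C that show thesis by metis
qed

lemma bfs_L0: "f \<in> bfs \<rho> \<Longrightarrow> f \<in> L0"
  by (simp add: bfs_def)

lemma N_nonneg [simp]: "0 \<le> N f"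
  by (simp add: bfs_norm_def)

lemma rho_eq_N: "f \<in> bfs \<rho> \<Longrightarrow> \<rho> (\<lambda>t. ennreal (norm (f t))) = ennreal (N f)"
  by (simp add: bfs_def bfs_norm_def)

lemma N_le_iff: "f \<in> bfs \<rho> \<Longrightarrow> 0 \<le> B \<Longrightarrow> N f \<le> B \<longleftrightarrow> \<rho> (\<lambda>t. ennreal (norm (f t))) \<le> ennreal B"
  by (simp add: rho_eq_N)

lemma bfsI: "f \<in> L0 \<Longrightarrow> \<rho> (\<lambda>t. ennreal (norm (f t))) \<le> ennreal B \<Longrightarrow> f \<in> bfs \<rho>"
  by (auto simp: bfs_def top_unique less_top[symmetric])

lemma norm_L0_plus [measurable]: "f \<in> L0 \<Longrightarrow> (\<lambda>t. ennreal (norm (f t))) \<in> L0_plus"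
  by measurable

lemma bfs_mono:
  assumes g: "g \<in> bfs \<rho>" and f: "f \<in> L0" and le: "AE t in circle. norm (f t) \<le> norm (g t)"
  shows "f \<in> bfs \<rho>" "N f \<le> N g"
proof -
  have *: "\<rho> (\<lambda>t. ennreal (norm (f t))) \<le> ennreal (N g)"
    unfolding rho_eq_N[OF g, symmetric] using le bfs_L0[OF g] f
    by (intro rho_mono) (auto intro!: ennreal_leI elim!: eventually_mono)
  show "f \<in> bfs \<rho>" using f * by (rule bfsI)
  with * show "N f \<le> N g" by (simp add: N_le_iff)
qed

lemma N_cong_AE:
  assumes g: "g \<in> bfs \<rho>" and f: "f \<in> L0" and eq: "AE t in circle. norm (f t) = norm (g t)"
  shows "f \<in> bfs \<rho>" "N f = N g"
proof -
  have "AE t in circle. norm (f t) \<le> norm (g t)" "AE t in circle. norm (g t) \<le> norm (f t)"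
    using eq by (auto elim!: eventually_mono)
  then show "f \<in> bfs \<rho>" "N f = N g"
    using bfs_mono[of g f] bfs_mono[of f g] g f by (auto simp: bfs_L0 intro: antisym)
qed

lemma bfs_add:
  assumes f: "f \<in> bfs \<rho>" and g: "g \<in> bfs \<rho>"
  shows "(\<lambda>t. f t + g t) \<in> bfs \<rho>" "N (\<lambda>t. f t + g t) \<le> N f + N g"
proof -
  have [measurable]: "f \<in> L0" "g \<in> L0" using f g by (auto simp: bfs_L0)
  have "\<rho> (\<lambda>t. ennreal (norm (f t + g t))) \<le> \<rho> (\<lambda>t. ennreal (norm (f t)) + ennreal (norm (g t)))"
    by (intro rho_mono)
      (auto simp: ennreal_plus[symmetric] simp del: ennreal_plus intro!: ennreal_leI norm_triangle_ineq)
  also have "\<dots> \<le> \<rho> (\<lambda>t. ennreal (norm (f t))) + \<rho> (\<lambda>t. ennreal (norm (g t)))"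
    by (intro rho_add) measurable
  also have "\<dots> = ennreal (N f + N g)"
    by (simp add: rho_eq_N f g)
  finally have *: "\<rho> (\<lambda>t. ennreal (norm (f t + g t))) \<le> ennreal (N f + N g)" .
  show **: "(\<lambda>t. f t + g t) \<in> bfs \<rho>" by (rule bfsI[OF _ *]) measurable
  show "N (\<lambda>t. f t + g t) \<le> N f + N g"
    using * by (subst N_le_iff[OF **]) auto
qed

lemma bfs_mult_const:
  assumes f: "f \<in> bfs \<rho>"
  shows "(\<lambda>t. c * f t) \<in> bfs \<rho>" "N (\<lambda>t. c * f t) = norm c * N f"
proof -
  have [measurable]: "f \<in> L0" using f by (auto simp: bfs_L0)
  have "\<rho> (\<lambda>t. ennreal (norm (c * f t))) = \<rho> (\<lambda>t. ennreal (norm c) * ennreal (norm (f t)))"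
    by (simp add: norm_mult ennreal_mult)
  also have "\<dots> = ennreal (norm c) * \<rho> (\<lambda>t. ennreal (norm (f t)))"
    by (intro rho_scale) auto
  also have "\<dots> = ennreal (norm c * N f)"
    by (simp add: rho_eq_N f ennreal_mult)
  finally have *: "\<rho> (\<lambda>t. ennreal (norm (c * f t))) = ennreal (norm c * N f)" .
  show "(\<lambda>t. c * f t) \<in> bfs \<rho>" by (rule bfsI[OF _ eq_refl[OF *]]) measurable
  show "N (\<lambda>t. c * f t) = norm c * N f"
    unfolding bfs_norm_def[of _ "\<lambda>t. c * f t"] * by simp
qed

lemma bfs_diff:
  assumes f: "f \<in> bfs \<rho>" and g: "g \<in> bfs \<rho>"
  shows "(\<lambda>t. f t - g t) \<in> bfs \<rho>" "N (\<lambda>t. f t - g t) \<le> N f + N g"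
  using bfs_add[OF f bfs_mult_const(1)[OF g, of "-1"]] bfs_mult_const(2)[OF g, of "-1"]
  by simp_all

lemma N_minus_commute: "N (\<lambda>t. f t - g t) = N (\<lambda>t. g t - f t)"
  by (simp add: bfs_norm_def norm_minus_commute)

lemma N_triangle:
  assumes "f \<in> bfs \<rho>" "g \<in> bfs \<rho>" "h \<in> bfs \<rho>"
  shows "N (\<lambda>t. f t - h t) \<le> N (\<lambda>t. f t - g t) + N (\<lambda>t. g t - h t)"
  using bfs_add(2)[OF bfs_diff(1)[OF assms(1,2)] bfs_diff(1)[OF assms(2,3)]] by simp

lemma one_bfs: "(\<lambda>t. 1) \<in> bfs \<rho>"
proof -
  have "\<rho> (\<lambda>t. ennreal (norm (1::complex))) \<le> \<rho> (indicator (space circle))"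
    by (intro rho_mono AE_I2) (auto simp del: space_circle)
  then show ?thesis
    using rho_indicator_finite[OF sets.top] by (auto simp: bfs_def intro: le_less_trans)
qed

text \<open>The constant 1 lies in X by (A4), so every uniform estimate becomes a norm estimate at
  the price of the factor \<open>N (\<lambda>t. 1)\<close>.\<close>

lemma bounded_bfs:
  assumes f: "f \<in> L0" and B: "AE t in circle. norm (f t) \<le> B" "0 \<le> B"
  shows "f \<in> bfs \<rho>" "N f \<le> B * N (\<lambda>t. 1)"
proof -
  have "AE t in circle. norm (f t) \<le> norm (complex_of_real B * 1)"
    using B by (auto elim!: eventually_mono)
  from bfs_mono[OF bfs_mult_const(1)[OF one_bfs] f this] bfs_mult_const(2)[OF one_bfs, of B] B(2)
  show "f \<in> bfs \<rho>" "N f \<le> B * N (\<lambda>t. 1)" by simp_all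
qed

lemma continuous_bfs:
  assumes "continuous_on (sphere 0 1) f"
  shows "f \<in> bfs \<rho>"
proof -
  have "bounded (f ` sphere 0 1)"
    using assms by (intro compact_imp_bounded compact_continuous_image) auto
  then obtain B where "B > 0" "\<forall>t\<in>sphere 0 1. norm (f t) \<le> B"
    by (auto simp: bounded_pos)
  then show ?thesis
    using assms by (intro bounded_bfs[where B=B] continuous_L0 AE_I2) auto
qed

lemma
  assumes "finite S" "\<And>i. i \<in> S \<Longrightarrow> f i \<in> bfs \<rho>"
  shows bfs_sum: "(\<lambda>t. \<Sum>i\<in>S. f i t) \<in> bfs \<rho>"
    and N_sum_le: "N (\<lambda>t. \<Sum>i\<in>S. f i t) \<le> (\<Sum>i\<in>S. N (f i))"
proof -
  from assms have "(\<lambda>t. \<Sum>i\<in>S. f i t) \<in> bfs \<rho> \<and> N (\<lambda>t. \<Sum>i\<in>S. f i t) \<le> (\<Sum>i\<in>S. N (f i))"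
  proof (induction S rule: finite_induct)
    case empty
    then show ?case using bounded_bfs[of "\<lambda>t. 0" 0] by simp
  next
    case (insert x F)
    then show ?case
      using bfs_add[of "f x" "\<lambda>t. \<Sum>i\<in>F. f i t"] by fastforce
  qed
  then show "(\<lambda>t. \<Sum>i\<in>S. f i t) \<in> bfs \<rho>" "N (\<lambda>t. \<Sum>i\<in>S. f i t) \<le> (\<Sum>i\<in>S. N (f i))"
    by blast+
qed

text \<open>The continuous embedding of X into L^1. It makes each Fourier coefficient a bounded
  linear functional on X.\<close>

lemma bfs_integrable:
  obtains C where "C > 0" "\<And>f. f \<in> bfs \<rho> \<Longrightarrow> integrable circle f"
    "\<And>f. f \<in> bfs \<rho> \<Longrightarrow> (LINT t|circle. norm (f t)) \<le> C * N f"
proof -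
  obtain C :: real where C: "C > 0" "\<And>f. f \<in> L0_plus \<Longrightarrow> (\<integral>\<^sup>+t. f t \<partial>circle) \<le> ennreal C * \<rho> f"
    using rho_integral_bound by blast
  have le: "(\<integral>\<^sup>+t. ennreal (norm (f t)) \<partial>circle) \<le> ennreal (C * N f)" if "f \<in> bfs \<rho>" for f
    using C(2)[OF norm_L0_plus[OF bfs_L0[OF that]]] C(1) by (simp add: rho_eq_N that ennreal_mult)
  have int: "integrable circle f" if "f \<in> bfs \<rho>" for f
    using le[OF that] bfs_L0[OF that] by (intro integrableI_bounded) (auto intro: le_less_trans)
  have "(LINT t|circle. norm (f t)) \<le> C * N f" if "f \<in> bfs \<rho>" for f
    using le[OF that] C(1) nn_integral_eq_integral[OF integrable_norm[OF int[OF that]]] by simp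
  with C(1) int that show thesis by metis
qed

lemma indicator_mult_bfs:
  assumes "f \<in> bfs \<rho>" "E \<in> sets circle"
  shows "(\<lambda>t. indicator E t * f t) \<in> bfs \<rho>"
proof -
  have [measurable]: "f \<in> L0" "E \<in> sets circle" using assms by (auto simp: bfs_L0)
  show ?thesis
    by (rule bfs_mono[OF assms(1)]) (auto simp: norm_mult indicator_def)
qed

section \<open>Absolute continuity of the norm and dominated convergence in X\<close>

text \<open>If the norm were not absolutely continuous, some \<open>f\<close> would restrict to infinitely many
  disjoint sets \<open>A k\<close> with norm bounded below; its restrictions to the unions of subfamilies
  then form an uncountable separated set.\<close>

lemma absolutely_continuous_norm:
  assumes sep: "bfs_separable \<rho>" and f: "f \<in> bfs \<rho>" and E: "\<And>n. E n \<in> sets circle" "decseq E"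
    and null: "AE t in circle. t \<notin> (\<Inter>n. E n)"
  shows "(\<lambda>n. N (\<lambda>t. indicator (E n) t * f t)) \<longlonglongrightarrow> 0"
proof (rule ccontr)
  have [measurable]: "f \<in> L0" "\<And>n. E n \<in> sets circle" using f E by (auto simp: bfs_L0)
  define a where "a n = N (\<lambda>t. indicator (E n) t * f t)" for n
  have dec: "a n \<le> a m" if "m \<le> n" for m n
    unfolding a_def
  proof (rule bfs_mono(2)[OF indicator_mult_bfs[OF f E(1)]])
    show "AE t in circle. norm (indicator (E n) t * f t) \<le> norm (indicator (E m) t * f t)"
      using decseqD[OF E(2) that] by (intro AE_I2) (auto simp: indicator_def)
  qed measurable
  assume "\<not> (\<lambda>n. N (\<lambda>t. indicator (E n) t * f t)) \<longlonglongrightarrow> 0"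
  \<comment> \<open>A nonincreasing nonnegative sequence that does not tend to 0 stays above a
    positive constant.\<close>
  then obtain \<delta> where \<delta>: "\<delta> > 0" "\<And>n. a n \<ge> \<delta>"
  proof -
    have "\<exists>\<delta>>0. \<forall>n. a n \<ge> \<delta>"
    proof (rule ccontr)
      assume *: "\<not> (\<exists>\<delta>>0. \<forall>n. a n \<ge> \<delta>)"
      have "a \<longlonglongrightarrow> 0"
      proof (rule LIMSEQ_I)
        fix r :: real assume "r > 0"
        with * obtain n where "a n < r" by (auto simp: not_le)
        then have "norm (a m - 0) < r" if "m \<ge> n" for m
          using dec[OF that] by (simp add: a_def)
        then show "\<exists>no. \<forall>m\<ge>no. norm (a m - 0) < r" by blast
      qed
      with \<open>\<not> (\<lambda>n. N (\<lambda>t. indicator (E n) t * f t)) \<longlonglongrightarrow> 0\<close> show False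
        unfolding a_def by simp
    qed
    then show thesis using that by blast
  qed
  \<comment> \<open>As \<open>m\<close> grows, \<open>E n - E m\<close> increases to
    \<open>E n\<close> up to the null intersection. By (A3) the norms of the restrictions of
    \<open>f\<close> tend to \<open>a n\<close> \<ge> \<delta>, so they exceed \<delta> / 2
    eventually.\<close>
  have ex: "\<exists>m>n. N (\<lambda>t. indicator (E n - E m) t * f t) > \<delta> / 2" for n
  proof -
    have "(\<lambda>m. \<rho> (\<lambda>t. ennreal (norm (indicator (E n - E m) t * f t)))) \<longlonglongrightarrow>
      \<rho> (\<lambda>t. ennreal (norm (indicator (E n) t * f t)))"
    proof (rule rho_incseq_tendsto)
      show "AE t in circle. incseq (\<lambda>m. ennreal (norm (indicator (E n - E m) t * f t))) \<and>
          (\<lambda>m. ennreal (norm (indicator (E n - E m) t * f t))) \<longlonglongrightarrow> ennreal (norm (indicator (E n) t * f t))"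
        using null
      proof eventually_elim
        case (elim t)
        then obtain k where "t \<notin> E k" by auto
        then have k: "t \<notin> E m" if "m \<ge> k" for m
          using decseqD[OF E(2) that] by auto
        show ?case
        proof
          show "incseq (\<lambda>m. ennreal (norm (indicator (E n - E m) t * f t)))"
            using E(2) by (intro monoI ennreal_leI) (auto simp: norm_mult indicator_def decseq_def)
          show "(\<lambda>m. ennreal (norm (indicator (E n - E m) t * f t))) \<longlonglongrightarrow> ennreal (norm (indicator (E n) t * f t))"
            by (rule tendsto_eventually)
              (auto simp: eventually_sequentially indicator_def k intro!: exI[of _ k])
        qed
      qed
    qed measurable
    moreover have "ennreal (\<delta> / 2) < \<rho> (\<lambda>t. ennreal (norm (indicator (E n) t * f t)))"
      using \<delta>(1) \<delta>(2)[of n] f E by (simp add: rho_eq_N indicator_mult_bfs a_def ennreal_less_iff)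
    ultimately have "\<forall>\<^sub>F m in sequentially. ennreal (\<delta> / 2) < \<rho> (\<lambda>t. ennreal (norm (indicator (E n - E m) t * f t)))"
      by (rule order_tendstoD)
    then have "\<forall>\<^sub>F m in sequentially. m > n \<and> \<delta> / 2 < N (\<lambda>t. indicator (E n - E m) t * f t)"
      using eventually_gt_at_top[of n]
      by eventually_elim (use f E \<delta> in \<open>simp add: rho_eq_N indicator_mult_bfs sets.Diff ennreal_less_iff\<close>)
    then show ?thesis
      by (auto simp: eventually_sequentially)
  qed
  then obtain s where s: "\<And>n. s n > n" "\<And>n. N (\<lambda>t. indicator (E n - E (s n)) t * f t) > \<delta> / 2"
    by metis
  \<comment> \<open>Iterating \<open>s\<close> from 0 cuts the decreasing sequence \<open>E\<close>
    into disjoint layers, each carrying norm above \<delta> / 2.\<close>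
  define r where "r k = (s ^^ k) 0" for k
  define A where "A k = E (r k) - E (r (Suc k))" for k
  have r: "r (Suc k) = s (r k)" for k by (simp add: r_def)
  have r_mono: "r i \<le> r j" if "i \<le> j" for i j
    using that by (rule lift_Suc_mono_le[rotated]) (use s(1) r in \<open>simp add: less_imp_le\<close>)
  have NA: "N (\<lambda>t. indicator (A k) t * f t) > \<delta> / 2" for k
    using s(2)[of "r k"] by (simp add: A_def r)
  have [measurable]: "A k \<in> sets circle" for k by (simp add: A_def)
  have disj: "i = j" if "t \<in> A i" "t \<in> A j" for i j t
  proof -
    have "\<not> Suc i \<le> j" if "t \<in> A i" "t \<in> A j" for i j
      using that decseqD[OF E(2) r_mono[of "Suc i" j]] by (auto simp: A_def)
    from this[of i j] this[of j i] that show ?thesis by simp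
  qed
  define g where "g S t = indicator (\<Union>k\<in>S. A k) t * f t" for S t
  have g: "g S \<in> bfs \<rho>" for S
    unfolding g_def using f by (intro indicator_mult_bfs sets.countable_UN) auto
  obtain D where D: "countable D" "bfs_dense_in \<rho> D (bfs \<rho>)"
    using sep by (auto simp: bfs_separable_def)
  \<comment> \<open>With accuracy \<delta> / 4, a common approximant for two index sets would bring
    \<open>g S\<close> and \<open>g T\<close> within \<delta> / 2 of each other, which the layers
    forbid.\<close>
  then have "\<forall>S. \<exists>d\<in>D. d \<in> bfs \<rho> \<and> N (\<lambda>t. g S t - d t) < \<delta> / 4"
    using g \<delta>(1) unfolding bfs_dense_in_def by (meson subsetD zero_less_divide_iff zero_less_numeral)
  then obtain d where d: "\<And>S. d S \<in> D" "\<And>S. d S \<in> bfs \<rho>" "\<And>S. N (\<lambda>t. g S t - d S t) < \<delta> / 4"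
    by metis
  have "inj d"
  proof (rule injI, rule ccontr)
    fix S T :: "nat set" assume eq: "d S = d T" and "S \<noteq> T"
    then obtain k where k: "k \<in> S \<longleftrightarrow> k \<notin> T" by auto
    have ind: "indicator (\<Union>k\<in>S. A k) t = (if k \<in> S then 1 else 0 :: complex)" if "t \<in> A k" for S t
      using disj that by (auto simp: indicator_def)
    \<comment> \<open>On the layer \<open>A k\<close>, exactly one of \<open>g S\<close> and
      \<open>g T\<close> equals \<open>f\<close> and the other vanishes.\<close>
    have "N (\<lambda>t. indicator (A k) t * f t) \<le> N (\<lambda>t. g S t - g T t)"
    proof (rule bfs_mono[OF bfs_diff(1)[OF g g]])
      show "AE t in circle. norm (indicator (A k) t * f t) \<le> norm (g S t - g T t)"
        using k by (intro AE_I2) (auto simp: g_def ind indicator_def[of "A k"])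
    qed measurable
    also have "\<dots> \<le> N (\<lambda>t. g S t - d S t) + N (\<lambda>t. d S t - g T t)"
      by (rule N_triangle[OF g d(2) g])
    also have "\<dots> = N (\<lambda>t. g S t - d S t) + N (\<lambda>t. g T t - d T t)"
      by (simp add: eq N_minus_commute[of "d T"])
    also have "\<dots> < \<delta> / 2" using d(3)[of S] d(3)[of T] by simp
    finally show False using NA[of k] by simp
  qed
  moreover have "countable (range d)"
    using D(1) d(1) by (rule_tac countable_subset[of _ D]) auto
  ultimately have "countable (UNIV :: nat set set)"
    by (simp add: countable_image_inj_eq)
  then have "\<exists>h :: nat \<Rightarrow> nat set. h ` UNIV = Pow UNIV"
    by (metis Pow_UNIV UNIV_not_empty range_from_nat_into)
  then show False using Cantors_theorem by blast
qed

text \<open>Let \<open>E n\<close> be the set where some difference \<open>F m - f\<close> with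
  \<open>m\<close> \<ge> \<open>n\<close> exceeds \<epsilon>. These sets decrease to a null set, and
  the n-th difference is at most \<epsilon> off \<open>E n\<close> and at most \<open>g\<close> in
  modulus on it. The norm of \<open>g\<close> restricted to \<open>E n\<close> tends to 0 by
  absolute continuity.\<close>

lemma dominated_convergence_bfs:
  assumes sep: "bfs_separable \<rho>" and g: "g \<in> bfs \<rho>" and F: "\<And>n. F n \<in> L0" and f: "f \<in> L0"
    and lim: "AE t in circle. (\<lambda>n. F n t) \<longlonglongrightarrow> f t"
    and dom: "\<And>n. AE t in circle. norm (F n t - f t) \<le> norm (g t)"
  shows "(\<lambda>n. N (\<lambda>t. F n t - f t)) \<longlonglongrightarrow> 0"
proof (rule LIMSEQ_I)
  fix r :: real assume r: "r > 0"
  have [measurable]: "f \<in> L0" "g \<in> L0" "\<And>n. F n \<in> L0" using f g F by (auto simp: bfs_L0)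
  \<comment> \<open>The summand 1 rules out division by 0 and makes the bound r / 2 for the constant
    part strict.\<close>
  define \<epsilon> where "\<epsilon> = r / (2 * (1 + N (\<lambda>t. 1)))"
  have \<epsilon>: "\<epsilon> > 0" "\<epsilon> * N (\<lambda>t. 1) < r / 2"
    using r add_pos_nonneg[OF zero_less_one N_nonneg[of "\<lambda>t. 1"]] by (auto simp: \<epsilon>_def field_simps)
  define E where "E n = {t \<in> space circle. \<exists>m\<ge>n. norm (F m t - f t) > \<epsilon>}" for n
  have E [measurable]: "E n \<in> sets circle" for n unfolding E_def by measurable
  have "AE t in circle. t \<notin> (\<Inter>n. E n)"
    using lim
  proof eventually_elim
    case (elim t)
    then obtain n where "\<forall>m\<ge>n. norm (F m t - f t) < \<epsilon>" using \<epsilon>(1) by (meson LIMSEQ_D)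
    then show ?case by (force simp: E_def)
  qed
  moreover have "decseq E" unfolding decseq_def E_def by (auto intro: order_trans)
  ultimately have "(\<lambda>n. N (\<lambda>t. indicator (E n) t * g t)) \<longlonglongrightarrow> 0"
    by (intro absolutely_continuous_norm sep g E)
  then have "\<forall>\<^sub>F n in sequentially. N (\<lambda>t. indicator (E n) t * g t) < r / 2"
    using r by (intro order_tendstoD(2)) auto
  then obtain n0 where n0: "\<And>n. n \<ge> n0 \<Longrightarrow> N (\<lambda>t. indicator (E n) t * g t) < r / 2"
    unfolding eventually_sequentially by blast
  have "N (\<lambda>t. F n t - f t) < r" if "n \<ge> n0" for n
  proof -
    \<comment> \<open>The majorant \<epsilon> + 1_E |g| with E = \<open>E n\<close>. The modulus of
      \<open>g\<close> is taken because \<open>g\<close> is complex: the modulus of the sum must be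
      the sum of the moduli.\<close>
    define u where "u t = complex_of_real \<epsilon> * 1 + indicator (E n) t * complex_of_real (norm (g t))" for t
    have g': "(\<lambda>t. complex_of_real (norm (g t))) \<in> bfs \<rho>"
      by (rule bfs_mono(1)[OF g]) auto
    have "u \<in> bfs \<rho>" "N u \<le> N (\<lambda>t. complex_of_real \<epsilon> * 1) + N (\<lambda>t. indicator (E n) t * complex_of_real (norm (g t)))"
      unfolding u_def[abs_def] by (rule bfs_add[OF bfs_mult_const(1)[OF one_bfs] indicator_mult_bfs[OF g' E]])+
    moreover have "N (\<lambda>t. complex_of_real \<epsilon> * 1) = \<epsilon> * N (\<lambda>t. 1)"
      unfolding bfs_mult_const(2)[OF one_bfs] using \<epsilon>(1) by simp
    ultimately have u: "u \<in> bfs \<rho>" "N u \<le> \<epsilon> * N (\<lambda>t. 1) + N (\<lambda>t. indicator (E n) t * complex_of_real (norm (g t)))"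
      by simp_all
    have "N (\<lambda>t. F n t - f t) \<le> N u"
    proof (rule bfs_mono[OF u(1)])
      show "AE t in circle. norm (F n t - f t) \<le> norm (u t)"
        using dom[of n] AE_space
      proof eventually_elim
        case (elim t)
        have "u t = complex_of_real (\<epsilon> + indicator (E n) t * norm (g t))"
          by (simp add: u_def indicator_def)
        then have "norm (u t) = \<epsilon> + indicator (E n) t * norm (g t)"
          using \<epsilon>(1) by (simp add: abs_of_nonneg del: of_real_add)
        moreover have "norm (F n t - f t) \<le> \<epsilon>" if "t \<notin> E n"
          using that elim by (force simp: E_def not_less)
        ultimately show ?case using elim \<epsilon>(1) by (cases "t \<in> E n") auto
      qed
    qed measurable
    also have "\<dots> < r"
      using u(2) \<epsilon>(2) n0[OF that] N_cong_AE(2)[of "\<lambda>t. indicator (E n) t * g t" "\<lambda>t. indicator (E n) t * complex_of_real (norm (g t))"]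
      by (simp add: norm_mult indicator_mult_bfs g)
    finally show ?thesis .
  qed
  then show "\<exists>no. \<forall>n\<ge>no. norm (N (\<lambda>t. F n t - f t) - 0) < r" by auto
qed

end

section \<open>Density of trigonometric polynomials\<close>

text \<open>The formula is required on the circle only, since identities such as
  \<open>cnj t = t powi (-1)\<close> fail elsewhere. Values off the circle are irrelevant to
  X.\<close>

definition trig_polynomials :: "(complex \<Rightarrow> complex) set" where
  "trig_polynomials =
     {q. \<exists>(S::int set) a. finite S \<and> (\<forall>t\<in>sphere 0 1. q t = (\<Sum>k\<in>S. a k * t powi k))}"

lemma trig_polynomialsE:
  assumes "q \<in> trig_polynomials"
  obtains S :: "int set" and a where "finite S" "\<And>t. norm t = 1 \<Longrightarrow> q t = (\<Sum>k\<in>S. a k * t powi k)"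
  using assms by (auto simp: trig_polynomials_def)

lemma trig_polynomials_cong:
  "q \<in> trig_polynomials \<Longrightarrow> (\<And>t. norm t = 1 \<Longrightarrow> q' t = q t) \<Longrightarrow> q' \<in> trig_polynomials"
  by (auto simp: trig_polynomials_def)

lemma trig_polynomials_monom: "(\<lambda>t. c * t powi k) \<in> trig_polynomials"
  unfolding trig_polynomials_def by (intro CollectI exI[of _ "{k}"] exI[of _ "\<lambda>_. c"]) auto

lemma trig_polynomials_const: "(\<lambda>t. c) \<in> trig_polynomials"
  using trig_polynomials_monom[of c 0] by simp

lemma sum_power_int_extend:
  fixes a :: "int \<Rightarrow> complex"
  assumes "finite U" "S \<subseteq> U"
  shows "(\<Sum>k\<in>S. a k * t powi k) = (\<Sum>k\<in>U. (if k \<in> S then a k else 0) * t powi k)"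
  using assms by (intro sum.mono_neutral_cong_left) auto

lemma trig_polynomials_add:
  assumes "p \<in> trig_polynomials" "q \<in> trig_polynomials"
  shows "(\<lambda>t. p t + q t) \<in> trig_polynomials"
proof -
  obtain S a where p: "finite S" "\<And>t. norm t = 1 \<Longrightarrow> p t = (\<Sum>k\<in>S. a k * t powi k)"
    using assms(1) by (rule trig_polynomialsE) blast
  obtain T b where q: "finite T" "\<And>t. norm t = 1 \<Longrightarrow> q t = (\<Sum>k\<in>T. b k * t powi k)"
    using assms(2) by (rule trig_polynomialsE) blast
  have "p t + q t = (\<Sum>k\<in>S \<union> T. ((if k \<in> S then a k else 0) + (if k \<in> T then b k else 0)) * t powi k)"
    if "norm t = 1" for t
    using p q that
    by (simp add: sum_power_int_extend[of "S \<union> T" S] sum_power_int_extend[of "S \<union> T" T]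
        sum.distrib[symmetric] algebra_simps)
  with p(1) q(1) show ?thesis
    unfolding trig_polynomials_def
    by (intro CollectI exI[of _ "S \<union> T"] exI[of _ "\<lambda>k. (if k \<in> S then a k else 0) + (if k \<in> T then b k else 0)"]) auto
qed

lemma trig_polynomials_sum:
  "finite I \<Longrightarrow> (\<And>i. i \<in> I \<Longrightarrow> p i \<in> trig_polynomials) \<Longrightarrow> (\<lambda>t. \<Sum>i\<in>I. p i t) \<in> trig_polynomials"
  by (induction I rule: finite_induct) (auto intro: trig_polynomials_add trig_polynomials_const)

lemma trig_polynomials_mult_monom:
  assumes "p \<in> trig_polynomials"
  shows "(\<lambda>t. c * t powi k * p t) \<in> trig_polynomials"
proof -
  obtain S a where p: "finite S" "\<And>t. norm t = 1 \<Longrightarrow> p t = (\<Sum>k\<in>S. a k * t powi k)"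
    using assms(1) by (rule trig_polynomialsE) blast
  show ?thesis
  proof (rule trig_polynomials_cong)
    show "(\<lambda>t. \<Sum>j\<in>S. (c * a j) * t powi (k + j)) \<in> trig_polynomials"
      by (intro trig_polynomials_sum p(1) trig_polynomials_monom)
    fix t :: complex assume "norm t = 1"
    then show "c * t powi k * p t = (\<Sum>j\<in>S. (c * a j) * t powi (k + j))"
      by (subst p(2), simp, subst power_int_add) (auto simp: sum_distrib_left mult_ac)
  qed
qed

lemma trig_polynomials_mult:
  assumes "p \<in> trig_polynomials" "q \<in> trig_polynomials"
  shows "(\<lambda>t. p t * q t) \<in> trig_polynomials"
proof -
  obtain S a where p: "finite S" "\<And>t. norm t = 1 \<Longrightarrow> p t = (\<Sum>k\<in>S. a k * t powi k)"
    using assms(1) by (rule trig_polynomialsE) blast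
  show ?thesis
  proof (rule trig_polynomials_cong)
    show "(\<lambda>t. \<Sum>j\<in>S. a j * t powi j * q t) \<in> trig_polynomials"
      by (intro trig_polynomials_sum p(1) trig_polynomials_mult_monom assms)
  qed (simp add: p(2) sum_distrib_right)
qed

lemma trig_polynomials_scale:
  "q \<in> trig_polynomials \<Longrightarrow> (\<lambda>t. c * q t) \<in> trig_polynomials"
  using trig_polynomials_mult_monom[of q c 0] by simp

lemma continuous_on_power_int_sphere [continuous_intros]:
  "continuous_on (sphere 0 1) (\<lambda>t::complex. t powi k)"
  by (intro continuous_intros) auto

lemma trig_polynomials_continuous:
  assumes "q \<in> trig_polynomials"
  shows "continuous_on (sphere 0 1) q"
proof -
  obtain S a where q: "finite S" "\<And>t. norm t = 1 \<Longrightarrow> q t = (\<Sum>k\<in>S. a k * t powi k)"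
    using assms(1) by (rule trig_polynomialsE) blast
  have "continuous_on (sphere 0 1) (\<lambda>t. \<Sum>k\<in>S. a k * t powi k)"
    by (intro continuous_intros)
  then show ?thesis by (rule continuous_on_eq) (simp add: q(2))
qed

text \<open>Trigonometric polynomials are closed under sums and products, so the linear functions
  decide. On the circle, Re t and Im t are combinations of t and its conjugate, which is the inverse
  of t.\<close>

lemma real_polynomial_function_trig:
  assumes "real_polynomial_function p"
  shows "(\<lambda>t. complex_of_real (p t)) \<in> trig_polynomials"
  using assms
proof induction
  case (linear f)
  interpret bounded_linear f by fact
  have f: "f t = Re t * f 1 + Im t * f \<i>" for t
  proof -
    have "f t = f (Re t *\<^sub>R 1 + Im t *\<^sub>R \<i>)"
      by (intro arg_cong[where f = f]) (simp add: complex_eq_iff)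
    then show ?thesis by (simp only: add scaleR real_scaleR_def)
  qed
  define \<alpha> \<beta> where "\<alpha> = complex_of_real (f 1)" and "\<beta> = complex_of_real (f \<i>)"
  show ?case
  proof (rule trig_polynomials_cong)
    \<comment> \<open>The coefficients come from inserting Re t = (t + cnj t) / 2 and Im t = (t -
      cnj t) / (2 i) into \<alpha> Re t + \<beta> Im t.\<close>
    show "(\<lambda>t. ((\<alpha> - \<i> * \<beta>) / 2) * t powi 1 + ((\<alpha> + \<i> * \<beta>) / 2) * t powi (-1)) \<in> trig_polynomials"
      by (intro trig_polynomials_add trig_polynomials_monom)
    fix t :: complex assume t: "norm t = 1"
    then have inv: "inverse t = cnj t"
      using complex_div_cnj[of 1 t] by (simp add: inverse_eq_divide)
    have inv: "t powi (-1) = cnj t" by (simp add: power_int_minus inv)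
    show "complex_of_real (f t) = ((\<alpha> - \<i> * \<beta>) / 2) * t powi 1 + ((\<alpha> + \<i> * \<beta>) / 2) * t powi (-1)"
      unfolding inv f[of t] \<alpha>_def \<beta>_def by (simp add: complex_eq_iff field_simps)
  qed
next
  case (add f g)
  then show ?case using trig_polynomials_add by simp
next
  case (mult f g)
  then show ?case using trig_polynomials_mult by simp
qed (auto intro: trig_polynomials_const)

text \<open>Stone-Weierstrass in the real plane gives a polynomial in Re t and Im t, whose two real
  components are trigonometric on the circle.\<close>

lemma trig_polynomials_uniformly_dense:
  assumes "continuous_on (sphere 0 1) f" "0 < e"
  shows "\<exists>q\<in>trig_polynomials. \<forall>t\<in>sphere 0 1. norm (f t - q t) < e"
proof -
  obtain g :: "complex \<Rightarrow> complex" where g: "polynomial_function g" "\<forall>t\<in>sphere 0 1. norm (f t - g t) < e"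
    using Stone_Weierstrass_polynomial_function[OF compact_sphere assms] by blast
  have "real_polynomial_function (\<lambda>t. Re (g t))" "real_polynomial_function (\<lambda>t. Im (g t))"
    using g(1) bounded_linear_Re bounded_linear_Im unfolding polynomial_function_def o_def by blast+
  then have "(\<lambda>t. complex_of_real (Re (g t)) + \<i> * complex_of_real (Im (g t))) \<in> trig_polynomials"
    by (intro trig_polynomials_add trig_polynomials_scale real_polynomial_function_trig)
  then have "g \<in> trig_polynomials"
    by (simp add: complex_eq[symmetric])
  with g(2) show ?thesis by blast
qed

lemma indicator_borel_L0:
  assumes "S \<in> sets borel"
  shows "(indicator S :: complex \<Rightarrow> complex) \<in> L0"
  unfolding circle_eq_completion
  by (rule measurable_completion[OF borel_measurable_circle0I[OF
        measurable_restrict_space1[OF borel_measurable_indicator[OF assms]]]])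

section \<open>The closure of the trigonometric polynomials in X\<close>

context bf_norm begin

definition trig_closure :: "(complex \<Rightarrow> complex) set" where
  "trig_closure = {f \<in> bfs \<rho>. \<forall>\<epsilon>>0. \<exists>q\<in>trig_polynomials. N (\<lambda>t. f t - q t) < \<epsilon>}"

lemma trig_bfs: "q \<in> trig_polynomials \<Longrightarrow> q \<in> bfs \<rho>"
  by (intro continuous_bfs trig_polynomials_continuous)

lemma trig_closureD: "f \<in> trig_closure \<Longrightarrow> f \<in> bfs \<rho>"
  by (simp add: trig_closure_def)

lemma trig_closureE:
  assumes "f \<in> trig_closure" "\<epsilon> > 0"
  obtains q where "q \<in> trig_polynomials" "N (\<lambda>t. f t - q t) < \<epsilon>"
  using assms by (auto simp: trig_closure_def)

lemma trig_closure_approx: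
  assumes f: "f \<in> bfs \<rho>" and *: "\<And>\<epsilon>. \<epsilon> > 0 \<Longrightarrow> \<exists>g\<in>trig_closure. N (\<lambda>t. f t - g t) < \<epsilon>"
  shows "f \<in> trig_closure"
  unfolding trig_closure_def
proof (safe intro!: f)
  fix \<epsilon> :: real assume \<epsilon>: "\<epsilon> > 0"
  obtain g where g: "g \<in> trig_closure" "N (\<lambda>t. f t - g t) < \<epsilon> / 2"
    using *[of "\<epsilon> / 2"] \<epsilon> by auto
  obtain q where q: "q \<in> trig_polynomials" "N (\<lambda>t. g t - q t) < \<epsilon> / 2"
    using trig_closureE[OF g(1), of "\<epsilon> / 2"] \<epsilon> by auto
  have "N (\<lambda>t. f t - q t) < \<epsilon>"
    using g(2) q(2) N_triangle[OF f trig_closureD[OF g(1)] trig_bfs[OF q(1)]] by linarith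
  then show "\<exists>q\<in>trig_polynomials. N (\<lambda>t. f t - q t) < \<epsilon>"
    using q(1) by blast
qed

lemma trig_closure_tendsto:
  assumes "f \<in> bfs \<rho>" "\<And>n::nat. F n \<in> trig_closure" "(\<lambda>n. N (\<lambda>t. F n t - f t)) \<longlonglongrightarrow> 0"
  shows "f \<in> trig_closure"
proof (rule trig_closure_approx[OF assms(1)])
  fix \<epsilon> :: real assume "\<epsilon> > 0"
  with assms(3) have "\<forall>\<^sub>F n in sequentially. N (\<lambda>t. F n t - f t) < \<epsilon>"
    by (rule order_tendstoD(2))
  then obtain n where "N (\<lambda>t. F n t - f t) < \<epsilon>"
    by (auto simp: eventually_sequentially)
  then show "\<exists>g\<in>trig_closure. N (\<lambda>t. f t - g t) < \<epsilon>"
    using assms(2) N_minus_commute by metis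
qed

text \<open>Functions equal a.e. are distinct objects here, so membership has to be transported
  explicitly; their difference is a.e. bounded by 0 and has norm 0.\<close>

lemma trig_closure_cong_AE:
  assumes f: "f \<in> trig_closure" and g: "g \<in> L0" and eq: "AE t in circle. g t = f t"
  shows "g \<in> trig_closure"
proof (rule trig_closure_approx)
  show g': "g \<in> bfs \<rho>"
    using eq by (intro N_cong_AE(1)[OF trig_closureD[OF f] g]) (auto elim!: eventually_mono)
  fix \<epsilon> :: real assume "\<epsilon> > 0"
  have "N (\<lambda>t. g t - f t) \<le> 0 * N (\<lambda>t. 1)"
  proof (rule bounded_bfs(2))
    show "(\<lambda>t. g t - f t) \<in> L0" by (intro bfs_L0 bfs_diff(1) g' trig_closureD[OF f])
    show "AE t in circle. norm (g t - f t) \<le> 0" using eq by eventually_elim simp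
  qed simp
  with \<open>\<epsilon> > 0\<close> show "\<exists>h\<in>trig_closure. N (\<lambda>t. g t - h t) < \<epsilon>"
    by (intro bexI[OF _ f]) simp
qed

lemma trig_closure_uniform:
  assumes f: "f \<in> L0" and *: "\<And>\<epsilon>. \<epsilon> > 0 \<Longrightarrow> \<exists>q\<in>trig_polynomials. \<forall>t\<in>sphere 0 1. norm (f t - q t) < \<epsilon>"
    and b: "f \<in> bfs \<rho>"
  shows "f \<in> trig_closure"
  unfolding trig_closure_def
proof (safe intro!: b)
  fix \<epsilon> :: real assume \<epsilon>: "\<epsilon> > 0"
  have pos: "1 + N (\<lambda>t. 1) > 0" by (rule add_pos_nonneg) auto
  obtain q where q: "q \<in> trig_polynomials" "\<forall>t\<in>sphere 0 1. norm (f t - q t) < \<epsilon> / (1 + N (\<lambda>t. 1))"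
    using *[of "\<epsilon> / (1 + N (\<lambda>t. 1))"] \<epsilon> pos by auto
  have "N (\<lambda>t. f t - q t) \<le> \<epsilon> / (1 + N (\<lambda>t. 1)) * N (\<lambda>t. 1)"
    using q \<epsilon> pos by (intro bounded_bfs bfs_L0[OF bfs_diff(1)[OF b trig_bfs]] AE_I2) (auto intro: less_imp_le)
  also have "\<dots> < \<epsilon>" using \<epsilon> pos by (simp add: field_simps)
  finally show "\<exists>q\<in>trig_polynomials. N (\<lambda>t. f t - q t) < \<epsilon>" using q by blast
qed

lemma continuous_trig_closure: "continuous_on (sphere 0 1) f \<Longrightarrow> f \<in> trig_closure"
  by (intro trig_closure_uniform trig_polynomials_uniformly_dense continuous_L0 continuous_bfs)

lemma trig_closure_add:
  assumes f: "f \<in> trig_closure" and g: "g \<in> trig_closure"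
  shows "(\<lambda>t. f t + g t) \<in> trig_closure"
  unfolding trig_closure_def
proof (intro CollectI conjI allI impI bfs_add(1) trig_closureD f g)
  fix \<epsilon> :: real assume \<epsilon>: "\<epsilon> > 0"
  obtain p where p: "p \<in> trig_polynomials" "N (\<lambda>t. f t - p t) < \<epsilon> / 2"
    using trig_closureE[OF f, of "\<epsilon> / 2"] \<epsilon> by auto
  obtain q where q: "q \<in> trig_polynomials" "N (\<lambda>t. g t - q t) < \<epsilon> / 2"
    using trig_closureE[OF g, of "\<epsilon> / 2"] \<epsilon> by auto
  have "N (\<lambda>t. (f t - p t) + (g t - q t)) \<le> N (\<lambda>t. f t - p t) + N (\<lambda>t. g t - q t)"
    by (intro bfs_add(2) bfs_diff(1) trig_bfs trig_closureD p(1) q(1) f g)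
  also have "\<dots> < \<epsilon>" using p(2) q(2) by simp
  finally show "\<exists>q\<in>trig_polynomials. N (\<lambda>t. f t + g t - q t) < \<epsilon>"
    by (intro bexI[OF _ trig_polynomials_add[OF p(1) q(1)]]) (simp add: algebra_simps)
qed

lemma trig_closure_scale:
  assumes f: "f \<in> trig_closure"
  shows "(\<lambda>t. c * f t) \<in> trig_closure"
  unfolding trig_closure_def
proof (intro CollectI conjI allI impI bfs_mult_const(1) trig_closureD f)
  fix \<epsilon> :: real assume \<epsilon>: "\<epsilon> > 0"
  then have "\<epsilon> / (1 + norm c) > 0" by (simp add: add_pos_nonneg)
  then obtain p where p: "p \<in> trig_polynomials" "N (\<lambda>t. f t - p t) < \<epsilon> / (1 + norm c)"
    using trig_closureE[OF f] by blast
  have "N (\<lambda>t. c * (f t - p t)) = norm c * N (\<lambda>t. f t - p t)"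
    using f p by (intro bfs_mult_const(2) bfs_diff(1) trig_bfs trig_closureD)
  also have "\<dots> \<le> norm c * (\<epsilon> / (1 + norm c))"
    using p(2) by (intro mult_left_mono) auto
  also have "\<dots> < \<epsilon>"
    using \<epsilon> add_pos_nonneg[OF zero_less_one norm_ge_zero[of c]] by (simp add: field_simps)
  finally show "\<exists>q\<in>trig_polynomials. N (\<lambda>t. c * f t - q t) < \<epsilon>"
    by (intro bexI[OF _ trig_polynomials_scale[OF p(1), of c]]) (simp add: algebra_simps)
qed

lemma trig_closure_sum:
  "finite I \<Longrightarrow> (\<And>i. i \<in> I \<Longrightarrow> F i \<in> trig_closure) \<Longrightarrow> (\<lambda>t. \<Sum>i\<in>I. F i t) \<in> trig_closure"
  by (induction I rule: finite_induct) (auto intro: trig_closure_add continuous_trig_closure)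

text \<open>Dominated convergence with majorant 1, tailored to approximations of indicator
  functions.\<close>

lemma trig_closure_bounded_limit:
  assumes sep: "bfs_separable \<rho>" and F: "\<And>n::nat. F n \<in> trig_closure" and f: "f \<in> L0"
    and lim: "\<And>t. norm t = 1 \<Longrightarrow> (\<lambda>n. F n t) \<longlonglongrightarrow> f t"
    and bd: "\<And>n t. norm t = 1 \<Longrightarrow> norm (F n t - f t) \<le> 1" "\<And>t. norm t = 1 \<Longrightarrow> norm (f t) \<le> 1"
  shows "f \<in> trig_closure"
proof (rule trig_closure_tendsto[OF _ F])
  show "f \<in> bfs \<rho>"
    using f bd by (intro bounded_bfs(1)[of _ 1] AE_I2) auto
  show "(\<lambda>n. N (\<lambda>t. F n t - f t)) \<longlonglongrightarrow> 0"
    using lim bd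
    by (intro dominated_convergence_bfs[OF sep one_bfs] bfs_L0 trig_closureD F f AE_I2) auto
qed

lemma indicator_closed_trig_closure:
  assumes sep: "bfs_separable \<rho>" and S: "closed S"
  shows "indicator S \<in> trig_closure"
\<comment> \<open>The empty set is separate because \<open>infdist t {}\<close> is 0 by convention,
  which would make every \<open>h n\<close> equal to 1.\<close>
proof (cases "S = {}")
  case True
  then have "(indicator S :: complex \<Rightarrow> complex) = (\<lambda>t. 0)" by auto
  then show ?thesis using continuous_trig_closure[of "\<lambda>t. 0"] by simp
next
  case False
  \<comment> \<open>Continuous functions that equal 1 on \<open>S\<close> and vanish at distance at
    least 1/n from it; they decrease to the indicator because \<open>S\<close> is closed.\<close>
  define h where "h n t = complex_of_real (max 0 (1 - real n * infdist t S))" for n t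
  have m: "(indicator S :: complex \<Rightarrow> complex) \<in> L0"
    using S by (intro indicator_borel_L0) auto
  show ?thesis
  proof (rule trig_closure_bounded_limit[OF sep _ m])
    show "h n \<in> trig_closure" for n
      unfolding h_def by (rule continuous_trig_closure) (intro continuous_intros)
    fix t :: complex
    have rng: "0 \<le> max 0 (1 - real n * infdist t S)" "max 0 (1 - real n * infdist t S) \<le> 1" for n
      by (auto simp: infdist_nonneg)
    have in_S: "h n t = 1" if "t \<in> S" for n using that by (simp add: h_def)
    show "norm (indicator S t :: complex) \<le> 1" by (simp add: indicator_def)
    show "norm (h n t - indicator S t) \<le> 1" for n
      using in_S[of n] rng[of n] by (auto simp: indicator_def h_def)
    show "(\<lambda>n. h n t) \<longlonglongrightarrow> indicator S t"
    proof (cases "t \<in> S")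
      case True
      then show ?thesis using in_S by simp
    next
      case F: False
      then have "infdist t S > 0"
        using S False infdist_nonneg[of t S] in_closed_iff_infdist_zero by (metis less_eq_real_def)
      then obtain n0 where "1 < real n0 * infdist t S"
        using reals_Archimedean3 by blast
      then have "h n t = 0" if "n \<ge> n0" for n
      proof -
        have "real n0 * infdist t S \<le> real n * infdist t S"
          using that \<open>infdist t S > 0\<close> by (intro mult_right_mono) auto
        with \<open>1 < real n0 * infdist t S\<close> show ?thesis by (simp add: h_def max_def)
      qed
      then show ?thesis using F
        by (intro tendsto_eventually) (auto simp: eventually_sequentially)
    qed
  qed
qed

text \<open>The Borel sets whose indicator lies in the closure form a Dynkin system: complements use
  1 minus the indicator, disjoint unions a bounded limit of partial sums. Closed sets are an
  intersection-stable generator, so no products of indicators occur.\<close>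

lemma indicator_borel_trig_closure:
  assumes sep: "bfs_separable \<rho>" and S: "S \<in> sets borel"
  shows "indicator S \<in> trig_closure"
proof -
  have "Int_stable {S :: complex set. closed S}" by (auto simp: Int_stable_def)
  moreover have "{S :: complex set. closed S} \<subseteq> Pow UNIV" by auto
  moreover have "S \<in> sigma_sets UNIV {S. closed S}"
    using S by (simp add: borel_eq_closed)
  ultimately show ?thesis
  proof (induction rule: sigma_sets_induct_disjoint)
    case (basic A)
    then show ?case using indicator_closed_trig_closure[OF sep] by simp
  next
    case empty
    show ?case by (rule indicator_closed_trig_closure[OF sep]) simp
  next
    case (compl A)
    have "(\<lambda>t. 1 + (-1) * indicator A t) \<in> trig_closure"
      by (intro trig_closure_add trig_closure_scale compl continuous_trig_closure continuous_intros)
    moreover have "(\<lambda>t. 1 + (-1) * indicator A t) = (indicator (UNIV - A) :: complex \<Rightarrow> complex)"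
      by (auto simp: indicator_def)
    ultimately show ?case by simp
  next
    case (union A)
    define F where "F n t = (\<Sum>i<n. indicator (A i) t :: complex)" for n t
    have F: "F n t = indicator (\<Union>i<n. A i) t" for n t
      using union(1) unfolding F_def
      by (subst indicator_UN_disjoint[symmetric]) (auto simp: disjoint_family_on_def)
    have "(\<Union>i. A i) \<in> sets borel"
      using union(2) by (intro sets.countable_UN) (auto simp: borel_eq_closed)
    then have m: "(indicator (\<Union>i. A i) :: complex \<Rightarrow> complex) \<in> L0"
      by (rule indicator_borel_L0)
    show ?case
    proof (rule trig_closure_bounded_limit[OF sep _ m])
      show "F n \<in> trig_closure" for n
        unfolding F_def by (intro trig_closure_sum union) auto
      fix t :: complex
      show "(\<lambda>n. F n t) \<longlonglongrightarrow> indicator (\<Union>i. A i) t"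
        unfolding F by (rule LIMSEQ_indicator_UN)
    qed (auto simp: F indicator_def)
  qed
qed

text \<open>A set measurable for the completion agrees, up to a null set, with its Borel main
  part.\<close>

lemma indicator_trig_closure:
  assumes sep: "bfs_separable \<rho>" and S: "S \<in> sets circle"
  shows "indicator S \<in> trig_closure"
proof -
  have "main_part circle0 S \<in> sets (restrict_space borel (sphere 0 1))"
    using main_part_sets[of S circle0] S by (simp add: circle_eq_completion sets_circle0)
  then obtain B where B: "B \<in> sets borel" "main_part circle0 S = sphere 0 1 \<inter> B"
    by (auto simp: sets_restrict_space)
  have "AE t in circle. t \<in> main_part circle0 S \<longleftrightarrow> t \<in> S"
    using AE_in_main_part[of S circle0] S unfolding circle_eq_completion by (intro AE_completion)
  then have "AE t in circle. (indicator S t :: complex) = indicator B t"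
    using AE_space by eventually_elim (auto simp: B indicator_def)
  then show ?thesis
    using S by (intro trig_closure_cong_AE[OF indicator_borel_trig_closure[OF sep B(1)]]) auto
qed

lemma trig_polynomials_dense:
  assumes sep: "bfs_separable \<rho>" and f: "f \<in> bfs \<rho>"
  shows "f \<in> trig_closure"
proof -
  have [measurable]: "f \<in> L0" by (rule bfs_L0[OF f])
  obtain F where F: "\<And>i::nat. simple_function circle (F i)"
      "\<And>t. t \<in> space circle \<Longrightarrow> (\<lambda>i. F i t) \<longlonglongrightarrow> f t"
      "\<And>i t. t \<in> space circle \<Longrightarrow> dist (F i t) 0 \<le> 2 * dist (f t) 0"
    using borel_measurable_implies_sequence_metric[OF bfs_L0[OF f], of 0] by blast
  have [measurable]: "F i \<in> L0" for i by (rule borel_measurable_simple_function[OF F(1)])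
  show ?thesis
  proof (rule trig_closure_tendsto[OF f])
    fix i
    have "(\<lambda>t. \<Sum>y\<in>F i ` space circle. y * indicator (F i -` {y} \<inter> space circle) t) \<in> trig_closure"
      using F(1)[of i]
      by (intro trig_closure_sum trig_closure_scale indicator_trig_closure sep) (auto simp: simple_function_def)
    then show "F i \<in> trig_closure"
    proof (rule trig_closure_cong_AE)
      show "AE t in circle. F i t = (\<Sum>y\<in>F i ` space circle. y * indicator (F i -` {y} \<inter> space circle) t)"
      proof (rule AE_I2)
        fix t assume "t \<in> space circle"
        from simple_function_indicator_representation_banach[OF F(1)[of i] this]
        show "F i t = (\<Sum>y\<in>F i ` space circle. y * indicator (F i -` {y} \<inter> space circle) t)"
          by (simp only: scaleR_conv_of_real of_real_indicator mult.commute)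
      qed
    qed measurable
  next
    show "(\<lambda>n. N (\<lambda>t. F n t - f t)) \<longlonglongrightarrow> 0"
    \<comment> \<open>The simple functions satisfy |F| \<le> 2 |f|, so the differences are at most 3
      |f|, a majorant in X even for unbounded \<open>f\<close>.\<close>
    proof (rule dominated_convergence_bfs[OF sep bfs_mult_const(1)[OF f, of 3]])
      show "AE t in circle. norm (F n t - f t) \<le> norm (3 * f t)" for n
      proof (rule AE_I2)
        fix t assume t: "t \<in> space circle"
        have "norm (F n t - f t) \<le> norm (F n t) + norm (f t)" by (rule norm_triangle_ineq4)
        also have "\<dots> \<le> norm (3 * f t)" using F(3)[OF t, of n] unfolding norm_mult dist_0_norm dist_norm by simp
        finally show "norm (F n t - f t) \<le> norm (3 * f t)" .
      qed
    qed (use F(2) in auto)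
  qed
qed

end

section \<open>Fejer means\<close>

text \<open>Truncation at 0 makes the weight vanish for every |k| > n, so that sums over different
  index sets can be compared by padding with zeros.\<close>

definition cesaro_weight :: "nat \<Rightarrow> int \<Rightarrow> real" where
  "cesaro_weight n k = max 0 (1 - of_int \<bar>k\<bar> / (real n + 1))"

definition fejer_kernel :: "nat \<Rightarrow> complex \<Rightarrow> complex" where
  "fejer_kernel n t = (\<Sum>k\<in>{-int n..int n}. of_real (cesaro_weight n k) * t powi k)"

text \<open>The coefficient formula replaces the convolution integral; it shows directly which
  frequencies survive.\<close>

definition fejer_mean :: "nat \<Rightarrow> (complex \<Rightarrow> complex) \<Rightarrow> complex \<Rightarrow> complex" where
  "fejer_mean n f t =
     (\<Sum>k\<in>{-int n..int n}. of_real (cesaro_weight n k) * fourier_coeff f k * t powi k)"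

lemma cesaro_weight_zero [simp]: "cesaro_weight n 0 = 1"
  by (simp add: cesaro_weight_def)

lemma cesaro_weight_eq_0: "k \<notin> {-int n..int n} \<Longrightarrow> cesaro_weight n k = 0"
  by (auto simp: cesaro_weight_def max_def field_simps)

lemma cesaro_weight_tendsto: "(\<lambda>n. cesaro_weight n k) \<longlonglongrightarrow> 1"
proof -
  have "(\<lambda>n. max 0 (1 - of_int \<bar>k\<bar> * inverse (real (Suc n)))) \<longlonglongrightarrow> max 0 (1 - of_int \<bar>k\<bar> * 0)"
    by (intro tendsto_intros LIMSEQ_inverse_real_of_nat)
  then show ?thesis by (simp add: cesaro_weight_def[abs_def] divide_inverse add.commute)
qed

text \<open>The coefficient of \<open>t powi k\<close> counts the pairs i, j \<le> n with j - i = k.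
  In the inductive step every coefficient with |k| \<le> n + 1 grows by one, which is exactly what
  the two cross terms and the new diagonal term contribute.\<close>

lemma fejer_kernel_square:
  assumes t: "norm t = 1"
  shows "(\<Sum>k\<in>{-int n..int n}. of_int (int n + 1 - \<bar>k\<bar>) * t powi k) =
    (\<Sum>j\<le>n. t ^ j) * cnj (\<Sum>j\<le>n. t ^ j)"
proof (induction n)
  case 0
  then show ?case by simp
next
  case (Suc n)
  let ?S = "\<Sum>j\<le>n. t ^ j"
  have t0: "t \<noteq> 0" using t by auto
  have inv: "cnj t = inverse t" using complex_div_cnj[of 1 t] t by (simp add: inverse_eq_divide)
  have pw: "t ^ j * cnj (t ^ i) = t powi (int j - int i)" for i j
    using t0 by (simp add: inv power_int_diff power_inverse divide_inverse)
  have a: "?S * cnj (t ^ Suc n) = (\<Sum>k\<in>{-int (Suc n)..-1}. t powi k)"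
  proof -
    have "?S * cnj (t ^ Suc n) = (\<Sum>j\<le>n. t powi (int j - int (Suc n)))"
      unfolding sum_distrib_right pw ..
    also have "\<dots> = (\<Sum>k\<in>{-int (Suc n)..-1}. t powi k)"
      by (rule sum.reindex_bij_witness[of _ "\<lambda>k. nat (k + int (Suc n))" "\<lambda>j. int j - int (Suc n)"]) auto
    finally show ?thesis .
  qed
  have b: "t ^ Suc n * cnj ?S = (\<Sum>k\<in>{1..int (Suc n)}. t powi k)"
  proof -
    have "t ^ Suc n * cnj ?S = (\<Sum>j\<le>n. t powi (int (Suc n) - int j))"
      unfolding cnj_sum sum_distrib_left pw ..
    also have "\<dots> = (\<Sum>k\<in>{1..int (Suc n)}. t powi k)"
      by (rule sum.reindex_bij_witness[of _ "\<lambda>k. nat (int (Suc n) - k)" "\<lambda>j. int (Suc n) - int j"]) auto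
    finally show ?thesis .
  qed
  have c: "t ^ Suc n * cnj (t ^ Suc n) = 1"
    unfolding pw by simp
  have "(\<Sum>k\<in>{-int (Suc n)..int (Suc n)}. of_int (int (Suc n) + 1 - \<bar>k\<bar>) * t powi k) =
    (\<Sum>k\<in>{-int (Suc n)..int (Suc n)}. of_int (int n + 1 - \<bar>k\<bar>) * t powi k) +
    (\<Sum>k\<in>{-int (Suc n)..int (Suc n)}. t powi k)"
    unfolding sum.distrib[symmetric] by (intro sum.cong) (auto simp: algebra_simps)
  \<comment> \<open>The two additional frequencies are k = n + 1 and k = -(n + 1), where the factor
    n + 1 - |k| is 0.\<close>
  also have "(\<Sum>k\<in>{-int (Suc n)..int (Suc n)}. of_int (int n + 1 - \<bar>k\<bar>) * t powi k) =
     (\<Sum>k\<in>{-int n..int n}. of_int (int n + 1 - \<bar>k\<bar>) * t powi k)"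
  proof (rule sum.mono_neutral_right)
    show "\<forall>k\<in>{-int (Suc n)..int (Suc n)} - {-int n..int n}. of_int (int n + 1 - \<bar>k\<bar>) * t powi k = 0"
    proof
      fix k assume "k \<in> {-int (Suc n)..int (Suc n)} - {-int n..int n}"
      then have "int n + 1 - \<bar>k\<bar> = 0" by auto
      then show "of_int (int n + 1 - \<bar>k\<bar>) * t powi k = 0" by simp
    qed
  qed auto
  also have "(\<Sum>k\<in>{-int (Suc n)..int (Suc n)}. t powi k) =
    (\<Sum>k\<in>{-int (Suc n)..-1}. t powi k) + 1 + (\<Sum>k\<in>{1..int (Suc n)}. t powi k)"
  proof -
    have "{-int (Suc n)..int (Suc n)} = {-int (Suc n)..-1} \<union> ({0} \<union> {1..int (Suc n)})" by auto
    then show ?thesis by (simp only:) (subst sum.union_disjoint; auto)+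
  qed
  finally show ?case
    unfolding Suc.IH a[symmetric] b[symmetric] using c
    by (simp add: algebra_simps del: power_Suc)
qed

text \<open>The kernel is the squared modulus of a geometric sum divided by n + 1.\<close>

lemma fejer_kernel_nonneg:
  assumes t: "norm t = 1"
  obtains \<kappa> where "\<kappa> \<ge> 0" "fejer_kernel n t = complex_of_real \<kappa>"
proof -
  let ?S = "\<Sum>j\<le>n. t ^ j"
  have w: "complex_of_real (cesaro_weight n k) = of_int (int n + 1 - \<bar>k\<bar>) / (of_nat n + 1)"
    if "k \<in> {-int n..int n}" for k
  proof -
    have "cesaro_weight n k = of_int (int n + 1 - \<bar>k\<bar>) / (real n + 1)"
    proof -
      have "of_int (int n + 1 - \<bar>k\<bar>) / (real n + 1) = 1 - of_int \<bar>k\<bar> / (real n + 1)"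
        by (simp add: field_simps)
      moreover have "of_int (int n + 1 - \<bar>k\<bar>) / (real n + 1) \<ge> 0"
        using that by (intro divide_nonneg_nonneg) auto
      ultimately show ?thesis by (simp add: cesaro_weight_def)
    qed
    then show ?thesis
      by (simp only: of_real_divide of_real_of_int_eq of_real_add of_real_1 of_real_of_nat_eq)
  qed
  have "fejer_kernel n t = (\<Sum>k\<in>{-int n..int n}. of_int (int n + 1 - \<bar>k\<bar>) * t powi k) / (of_nat n + 1)"
    unfolding fejer_kernel_def sum_divide_distrib by (intro sum.cong) (auto simp: w)
  also have "\<dots> = complex_of_real ((norm ?S)\<^sup>2 / (real n + 1))"
    unfolding fejer_kernel_square[OF t] complex_norm_square[symmetric] by simp
  finally show thesis by (intro that[of "(norm ?S)\<^sup>2 / (real n + 1)"]) auto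
qed

section \<open>Sampling at roots of unity\<close>

text \<open>For \<open>k\<close> \<noteq> 0 this is a geometric sum with ratio \<open>w\<close>,
  where \<open>w ^ M = 1\<close>; the bound on \<open>k\<close> excludes that \<open>M\<close>
  divides \<open>k\<close>, hence \<open>w\<close> \<noteq> 1.\<close>

lemma sum_roots_of_unity_power_int:
  assumes M: "M > 0" and k: "\<bar>k\<bar> < int M"
  shows "(\<Sum>j<M. cis (2 * pi * real j / real M) powi k) = (if k = 0 then of_nat M else 0)"
proof (cases "k = 0")
  case False
  define w where "w = cis (2 * pi * of_int k / real M)"
  have "cis (2 * pi * real j / real M) powi k = w ^ j" for j
    unfolding w_def cis_power_int Complex.DeMoivre by (intro arg_cong[where f = cis]) (simp add: mult_ac)
  moreover have "w ^ M = 1"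
    using M by (simp add: w_def Complex.DeMoivre cis_multiple_2pi)
  moreover have "w \<noteq> 1"
  proof
    assume "w = 1"
    then have "cos (2 * pi * of_int k / real M) = 1" by (simp add: w_def complex_eq_iff)
    then obtain m :: int where "2 * pi * of_int k / real M = of_int m * 2 * pi"
      by (auto simp: cos_one_2pi_int)
    then have "of_int k = (of_int m * of_int (int M) :: real)" using M by (simp add: field_simps)
    then have "k = m * int M" by (metis of_int_eq_iff of_int_mult)
    then have "int M dvd k" by simp
    then show False using dvd_imp_le_int[of k "int M"] False k by simp
  qed
  ultimately show ?thesis using False by (simp add: geometric_sum)
qed simp

lemma integrable_continuous_circle:
  fixes f :: "complex \<Rightarrow> complex"
  assumes "continuous_on (sphere 0 1) f"
  shows "integrable circle f"
proof -
  have "bounded (f ` sphere 0 1)"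
    using assms by (intro compact_imp_bounded compact_continuous_image) auto
  then obtain B where "\<forall>t\<in>sphere 0 1. norm (f t) \<le> B"
    by (auto simp: bounded_iff)
  then show ?thesis
    using assms by (intro circle.integrable_const_bound[where B=B] continuous_L0 AE_I2) auto
qed

lemma fejer_mean_trig_poly: "fejer_mean n f \<in> trig_polynomials"
  unfolding fejer_mean_def[abs_def] by (intro trig_polynomials_sum trig_polynomials_monom) auto

lemma fourier_coeff_trig:
  assumes S: "finite S" and q: "\<And>t. norm t = 1 \<Longrightarrow> q t = (\<Sum>k\<in>S. a k * t powi k)"
  shows "fourier_coeff q m = (if m \<in> S then a m else 0)"
proof -
  have cont: "continuous_on (sphere 0 1) q"
    using S q by (intro trig_polynomials_continuous) (auto simp: trig_polynomials_def)
  have "fourier_coeff q m = (LINT t|circle. q t * t powi (-m))"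
    by (rule fourier_coeff_eq_integral[OF continuous_L0[OF cont]])
  also have "\<dots> = (LINT t|circle. (\<Sum>k\<in>S. a k * t powi (k - m)))"
  proof (rule Bochner_Integration.integral_cong[OF refl])
    fix t assume "t \<in> space circle"
    then have t: "norm t = 1" "t \<noteq> 0" by auto
    then have pk: "t powi (k - m) = t powi k * t powi (-m)" for k
      by (subst power_int_add[symmetric]) auto
    show "q t * t powi (-m) = (\<Sum>k\<in>S. a k * t powi (k - m))"
      unfolding q[OF t(1)] sum_distrib_right pk by (simp only: mult.assoc)
  qed
  also have "\<dots> = (\<Sum>k\<in>S. a k * (LINT t|circle. t powi (k - m)))"
    by (subst Bochner_Integration.integral_sum)
      (auto intro!: integrable_continuous_circle continuous_intros)
  also have "\<dots> = (\<Sum>k\<in>S. if k = m then a k else 0)"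
    unfolding integral_circle_power_int by (intro sum.cong) auto
  also have "\<dots> = (if m \<in> S then a m else 0)"
    using S by simp
  finally show ?thesis .
qed

text \<open>Outside \<open>S\<close> the coefficients vanish and outside the window the weights do,
  so both index sets may be exchanged through their union.\<close>

lemma fejer_mean_trig:
  assumes S: "finite S" and q: "\<And>t. norm t = 1 \<Longrightarrow> q t = (\<Sum>k\<in>S. a k * t powi k)"
  shows "fejer_mean n q t = (\<Sum>k\<in>S. of_real (cesaro_weight n k) * a k * t powi k)"
proof -
  have "fejer_mean n q t =
    (\<Sum>k\<in>{-int n..int n}. of_real (cesaro_weight n k) * (if k \<in> S then a k else 0) * t powi k)"
    unfolding fejer_mean_def by (simp only: fourier_coeff_trig[OF S q])
  also have "\<dots> = (\<Sum>k\<in>{-int n..int n} \<union> S. of_real (cesaro_weight n k) * (if k \<in> S then a k else 0) * t powi k)"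
    using S by (intro sum.mono_neutral_left) (auto simp: cesaro_weight_eq_0)
  also have "\<dots> = (\<Sum>k\<in>S. of_real (cesaro_weight n k) * a k * t powi k)"
    using S by (intro sum.mono_neutral_cong_right) auto
  finally show ?thesis .
qed

text \<open>Sampling the convolution with the Fejer kernel at the \<open>M\<close>-th roots of unity is exact once
  \<open>M\<close> exceeds all the frequency differences: no aliasing occurs.\<close>

lemma fejer_mean_trig_sampling:
  assumes S: "finite S" and q: "\<And>t. norm t = 1 \<Longrightarrow> q t = (\<Sum>k\<in>S. a k * t powi k)"
    and M: "M > 0" "\<And>k. k \<in> S \<Longrightarrow> int n + \<bar>k\<bar> < int M" and t: "norm t = 1"
  shows "(\<Sum>j<M. fejer_kernel n (cis (2 * pi * real j / real M)) * q (cnj (cis (2 * pi * real j / real M)) * t)) =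
    of_nat M * fejer_mean n q t"
proof -
  define \<omega> where "\<omega> j = cis (2 * pi * real j / real M)" for j
  have \<omega>: "norm (\<omega> j) = 1" "cnj (\<omega> j) = inverse (\<omega> j)" "\<omega> j \<noteq> 0" for j
    by (simp_all add: \<omega>_def cis_cnj cis_inverse)
  have "(\<Sum>j<M. fejer_kernel n (\<omega> j) * q (cnj (\<omega> j) * t)) =
    (\<Sum>j<M. \<Sum>k\<in>{-int n..int n}. \<Sum>m\<in>S. of_real (cesaro_weight n k) * a m * t powi m * \<omega> j powi (k - m))"
  proof (rule sum.cong[OF refl])
    fix j
    have a: "q (cnj (\<omega> j) * t) = (\<Sum>m\<in>S. a m * (\<omega> j powi (-m) * t powi m))"
      by (subst q) (use t \<omega> in \<open>auto simp: norm_mult norm_inverse power_int_mult_distrib power_int_minus power_int_inverse\<close>)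
    have b: "\<omega> j powi (k - m) = \<omega> j powi k * \<omega> j powi (-m)" for k m
      by (subst power_int_add[symmetric]) (use \<omega> in auto)
    show "fejer_kernel n (\<omega> j) * q (cnj (\<omega> j) * t) =
      (\<Sum>k\<in>{-int n..int n}. \<Sum>m\<in>S. of_real (cesaro_weight n k) * a m * t powi m * \<omega> j powi (k - m))"
      unfolding fejer_kernel_def a b sum_product by (intro sum.cong refl) (simp only: mult_ac)
  qed
  also have "\<dots> = (\<Sum>k\<in>{-int n..int n}. \<Sum>j<M. \<Sum>m\<in>S. of_real (cesaro_weight n k) * a m * t powi m * \<omega> j powi (k - m))"
    by (rule sum.swap)
  also have "\<dots> = (\<Sum>k\<in>{-int n..int n}. \<Sum>m\<in>S. \<Sum>j<M. of_real (cesaro_weight n k) * a m * t powi m * \<omega> j powi (k - m))"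
    by (intro sum.cong refl sum.swap)
  \<comment> \<open>Since |k - m| \<le> n + |m| < M, the sum over \<open>j\<close> keeps only the
    diagonal k = m.\<close>
  also have "\<dots> = (\<Sum>k\<in>{-int n..int n}. \<Sum>m\<in>S. of_real (cesaro_weight n k) * a m * t powi m * (if k = m then of_nat M else 0))"
  proof (intro sum.cong refl)
    fix k m assume km: "k \<in> {-int n..int n}" "m \<in> S"
    then have "\<bar>k - m\<bar> < int M" using M(2)[of m] by auto
    then show "(\<Sum>j<M. of_real (cesaro_weight n k) * a m * t powi m * \<omega> j powi (k - m)) =
      of_real (cesaro_weight n k) * a m * t powi m * (if k = m then of_nat M else 0)"
      unfolding sum_distrib_left[symmetric] \<omega>_def using M(1)
      by (subst sum_roots_of_unity_power_int) auto
  qed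
  also have "\<dots> = (\<Sum>k\<in>{-int n..int n}. of_nat M * (of_real (cesaro_weight n k) * (if k \<in> S then a k else 0) * t powi k))"
    using S by (intro sum.cong refl) (simp add: if_distrib[of "\<lambda>x. _ * x"] mult_ac cong: if_cong)
  also have "\<dots> = of_nat M * fejer_mean n q t"
    unfolding fejer_mean_def sum_distrib_left by (simp only: fourier_coeff_trig[OF S q])
  finally show ?thesis by (simp add: \<omega>_def)
qed

text \<open>The sampling identity for the constant function 1: the sampled kernel values have
  average 1, which makes the combination of rotations convex.\<close>

lemma fejer_kernel_sampling:
  assumes "int n < int M"
  shows "(\<Sum>j<M. fejer_kernel n (cis (2 * pi * real j / real M))) = of_nat M"
  using fejer_mean_trig_sampling[of "{0}" "\<lambda>t. 1" "\<lambda>k. 1" M n 1] assms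
    fejer_mean_trig[of "{0}" "\<lambda>t. 1" "\<lambda>k. 1" n 1] by simp

section \<open>Contractivity and convergence of the Fejer means on X\<close>

context bf_norm begin

lemma N_rotation:
  assumes ri: "rearrangement_invariant \<rho>" and q: "continuous_on (sphere 0 1) q" and s: "norm s = 1"
  shows "(\<lambda>t. q (s * t)) \<in> bfs \<rho>" "N (\<lambda>t. q (s * t)) = N q"
proof -
  have "continuous_on (sphere 0 1) (\<lambda>t. q (s * t))"
    using s by (intro continuous_on_compose2[OF q] continuous_intros) (auto simp: norm_mult)
  then show "(\<lambda>t. q (s * t)) \<in> bfs \<rho>" "N (\<lambda>t. q (s * t)) = N q"
    using ri equimeasurable_rotation[OF continuous_measurable_circle0[OF q] s] continuous_bfs q continuous_L0
    unfolding rearrangement_invariant_def by metis+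
qed

lemma N_fejer_mean_trig_le:
  assumes ri: "rearrangement_invariant \<rho>" and q: "q \<in> trig_polynomials"
  shows "N (fejer_mean n q) \<le> N q"
proof -
  obtain S a where S: "finite S" "\<And>t. norm t = 1 \<Longrightarrow> q t = (\<Sum>k\<in>S. a k * t powi k)"
    using q by (rule trig_polynomialsE) blast
  \<comment> \<open>The sum of all |k| is a convenient upper bound for their maximum and also covers
    an empty \<open>S\<close>.\<close>
  define M where "M = Suc (n + nat (\<Sum>k\<in>S. \<bar>k\<bar>))"
  have M: "int n + \<bar>k\<bar> < int M" if "k \<in> S" for k
  proof -
    have "\<bar>k\<bar> \<le> (\<Sum>k\<in>S. \<bar>k\<bar>)" using S(1) that by (intro member_le_sum) auto
    then show "int n + \<bar>k\<bar> < int M" by (simp add: M_def)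
  qed
  have M': "M > 0" "int n < int M" unfolding M_def by linarith+
  define \<omega> where "\<omega> j = cis (2 * pi * real j / real M)" for j
  have \<omega>: "norm (\<omega> j) = 1" "norm (cnj (\<omega> j)) = 1" for j by (simp_all add: \<omega>_def)
  have "\<exists>\<kappa>\<ge>0. fejer_kernel n (\<omega> j) = complex_of_real \<kappa>" for j
    using fejer_kernel_nonneg[OF \<omega>(1)] by metis
  then obtain \<kappa> where \<kappa>: "\<And>j. \<kappa> j \<ge> 0" "\<And>j. fejer_kernel n (\<omega> j) = complex_of_real (\<kappa> j)"
    by metis
  have "complex_of_real (\<Sum>j<M. \<kappa> j) = complex_of_real (real M)"
    using fejer_kernel_sampling[OF M'(2)] by (simp add: \<kappa>(2) \<omega>_def[symmetric])
  then have sum: "(\<Sum>j<M. \<kappa> j) = real M"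
    by (simp only: of_real_eq_iff)
  have b: "(\<lambda>t. of_real (\<kappa> j) * q (cnj (\<omega> j) * t)) \<in> bfs \<rho>"
    "N (\<lambda>t. of_real (\<kappa> j) * q (cnj (\<omega> j) * t)) = \<kappa> j * N q" for j
    using bfs_mult_const[OF N_rotation(1)[OF ri trig_polynomials_continuous[OF q] \<omega>(2)]]
      N_rotation(2)[OF ri trig_polynomials_continuous[OF q] \<omega>(2)] \<kappa>(1)
    by simp_all
  have "real M * N (fejer_mean n q) = N (\<lambda>t. of_nat M * fejer_mean n q t)"
    using bfs_mult_const(2)[OF trig_bfs[OF fejer_mean_trig_poly], of "of_nat M"] by simp
  also have "\<dots> = N (\<lambda>t. \<Sum>j<M. of_real (\<kappa> j) * q (cnj (\<omega> j) * t))"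
  proof (rule N_cong_AE(2))
    have "\<And>t. norm t = 1 \<Longrightarrow> of_nat M * fejer_mean n q t = (\<Sum>j<M. of_real (\<kappa> j) * q (cnj (\<omega> j) * t))"
      using fejer_mean_trig_sampling[OF S M'(1) M] by (simp add: \<omega>_def[symmetric] \<kappa>(2)[symmetric])
    then show "AE t in circle. norm (of_nat M * fejer_mean n q t) = norm (\<Sum>j<M. of_real (\<kappa> j) * q (cnj (\<omega> j) * t))"
      by (intro AE_I2) auto
    show "(\<lambda>t. of_nat M * fejer_mean n q t) \<in> L0"
      by (rule bfs_L0[OF bfs_mult_const(1)[OF trig_bfs[OF fejer_mean_trig_poly]]])
  qed (intro bfs_sum b(1) finite_lessThan)
  also have "\<dots> \<le> (\<Sum>j<M. N (\<lambda>t. of_real (\<kappa> j) * q (cnj (\<omega> j) * t)))"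
    by (intro N_sum_le b(1) finite_lessThan)
  also have "\<dots> = real M * N q"
    by (simp add: b(2) sum_distrib_right[symmetric] sum)
  finally show ?thesis using M'(1) by simp
qed

text \<open>Each coefficient is at most the L^1 norm, hence at most \<open>C * N f\<close>. The
  constant \<open>B\<close> depends on \<open>n\<close>; it serves only as continuity of the n-th
  mean.\<close>

lemma fejer_mean_bounded:
  obtains B where "B \<ge> 0" "\<And>f. f \<in> bfs \<rho> \<Longrightarrow> N (fejer_mean n f) \<le> B * N f"
proof -
  obtain C where C: "C > 0" "\<And>f. f \<in> bfs \<rho> \<Longrightarrow> integrable circle f"
    "\<And>f. f \<in> bfs \<rho> \<Longrightarrow> (LINT t|circle. norm (f t)) \<le> C * N f"
    using bfs_integrable by metis
  have fc: "norm (fourier_coeff f k) \<le> C * N f" if "f \<in> bfs \<rho>" for f k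
  proof -
    have "norm (fourier_coeff f k) \<le> (LINT t|circle. norm (f t * t powi (-k)))"
      unfolding fourier_coeff_eq_integral[OF bfs_L0[OF that]] by (rule integral_norm_bound)
    also have "\<dots> = (LINT t|circle. norm (f t))"
      by (intro Bochner_Integration.integral_cong) (auto simp: norm_mult norm_power_int)
    also have "\<dots> \<le> C * N f" by (rule C(3)[OF that])
    finally show ?thesis .
  qed
  define B where "B = (\<Sum>k\<in>{-int n..int n}. \<bar>cesaro_weight n k\<bar> * C * N (\<lambda>t. t powi k))"
  have "N (fejer_mean n f) \<le> B * N f" if f: "f \<in> bfs \<rho>" for f
  proof -
    have b: "(\<lambda>t. of_real (cesaro_weight n k) * fourier_coeff f k * t powi k) \<in> bfs \<rho>"
      "N (\<lambda>t. of_real (cesaro_weight n k) * fourier_coeff f k * t powi k) =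
        norm (of_real (cesaro_weight n k) * fourier_coeff f k) * N (\<lambda>t. t powi k)" for k
      by (intro bfs_mult_const continuous_bfs continuous_intros)+
    have "N (fejer_mean n f) \<le> (\<Sum>k\<in>{-int n..int n}. N (\<lambda>t. of_real (cesaro_weight n k) * fourier_coeff f k * t powi k))"
      unfolding fejer_mean_def[abs_def] by (intro N_sum_le b(1) finite_atLeastAtMost_int)
    also have "\<dots> \<le> (\<Sum>k\<in>{-int n..int n}. \<bar>cesaro_weight n k\<bar> * (C * N f) * N (\<lambda>t. t powi k))"
      unfolding b(2) norm_mult norm_of_real using fc[OF f]
      by (intro sum_mono mult_right_mono mult_left_mono) auto
    also have "\<dots> = B * N f" unfolding B_def sum_distrib_right by (intro sum.cong refl) (simp only: mult_ac)
    finally show ?thesis .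
  qed
  moreover have "B \<ge> 0" unfolding B_def using C(1) by (intro sum_nonneg mult_nonneg_nonneg) auto
  ultimately show thesis using that by blast
qed

lemma fejer_mean_diff:
  assumes f: "f \<in> bfs \<rho>" and g: "g \<in> bfs \<rho>"
  shows "fejer_mean n (\<lambda>t. f t - g t) t = fejer_mean n f t - fejer_mean n g t"
proof -
  obtain C where "\<And>f. f \<in> bfs \<rho> \<Longrightarrow> integrable circle f"
    using bfs_integrable by metis
  then have i: "integrable circle f" "integrable circle g" using f g by auto
  have i': "integrable circle (\<lambda>t. h t * t powi (-k))" if "integrable circle h" for h k
  proof (rule Bochner_Integration.integrable_bound[OF that])
    have "(\<lambda>t::complex. t powi (-k)) \<in> L0" by (intro continuous_L0 continuous_intros)
    then show "(\<lambda>t. h t * t powi (-k)) \<in> L0" using that by measurable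
  qed (auto simp: norm_mult norm_power_int)
  have d: "fourier_coeff (\<lambda>t. f t - g t) k = fourier_coeff f k - fourier_coeff g k" for k
    using i'[OF i(1)] i'[OF i(2)] f g
    by (simp add: fourier_coeff_eq_integral bfs_L0 bfs_diff(1) left_diff_distrib)
  show ?thesis
    unfolding fejer_mean_def d sum_subtractf[symmetric] by (simp add: algebra_simps)
qed

lemma N_fejer_mean_le:
  assumes ri: "rearrangement_invariant \<rho>" and sep: "bfs_separable \<rho>" and f: "f \<in> bfs \<rho>"
  shows "N (fejer_mean n f) \<le> N f"
proof (rule field_le_epsilon)
  fix e :: real assume e: "e > 0"
  obtain B where B: "B \<ge> 0" "\<And>f. f \<in> bfs \<rho> \<Longrightarrow> N (fejer_mean n f) \<le> B * N f"
    using fejer_mean_bounded by metis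
  \<comment> \<open>With d the distance from \<open>f\<close> to \<open>q\<close>, the mean of
    \<open>f - q\<close> costs B d and the comparison of \<open>N q\<close> with \<open>N f\<close>
    costs d, in total (1 + B) d.\<close>
  have "e / (1 + B) > 0" using e B(1) by simp
  then obtain q where q: "q \<in> trig_polynomials" "N (\<lambda>t. f t - q t) < e / (1 + B)"
    using trig_closureE[OF trig_polynomials_dense[OF sep f]] by blast
  have q': "q \<in> bfs \<rho>" by (rule trig_bfs[OF q(1)])
  have fq: "(\<lambda>t. f t - q t) \<in> bfs \<rho>" by (rule bfs_diff(1)[OF f q'])
  have "N (fejer_mean n f) = N (\<lambda>t. fejer_mean n (\<lambda>t. f t - q t) t + fejer_mean n q t)"
    by (simp add: fejer_mean_diff f q')
  also have "\<dots> \<le> N (fejer_mean n (\<lambda>t. f t - q t)) + N (fejer_mean n q)"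
    by (rule bfs_add(2)[OF trig_bfs[OF fejer_mean_trig_poly] trig_bfs[OF fejer_mean_trig_poly]])
  also have "\<dots> \<le> B * N (\<lambda>t. f t - q t) + N q"
    by (intro add_mono B(2) fq N_fejer_mean_trig_le ri q(1))
  also have "N q \<le> N f + N (\<lambda>t. f t - q t)"
    using bfs_diff(2)[OF f fq] by simp
  also have "B * N (\<lambda>t. f t - q t) + (N f + N (\<lambda>t. f t - q t)) = N f + (1 + B) * N (\<lambda>t. f t - q t)"
    by (simp add: algebra_simps)
  also have "\<dots> \<le> N f + e"
    using q(2) B(1) by (simp add: field_simps)
  finally show "N (fejer_mean n f) \<le> N f + e" by simp
qed

lemma fejer_mean_trig_tendsto:
  assumes "q \<in> trig_polynomials"
  shows "(\<lambda>n. N (\<lambda>t. fejer_mean n q t - q t)) \<longlonglongrightarrow> 0"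
proof -
  obtain S a where S: "finite S" "\<And>t. norm t = 1 \<Longrightarrow> q t = (\<Sum>k\<in>S. a k * t powi k)"
    using assms by (rule trig_polynomialsE) blast
  have b: "(\<lambda>t. of_real (cesaro_weight n k - 1) * a k * t powi k) \<in> bfs \<rho>"
      "N (\<lambda>t. of_real (cesaro_weight n k - 1) * a k * t powi k) =
        norm (of_real (cesaro_weight n k - 1) * a k) * N (\<lambda>t. t powi k)" for n k
    by (intro bfs_mult_const continuous_bfs continuous_intros)+
  have le: "N (\<lambda>t. fejer_mean n q t - q t) \<le>
    (\<Sum>k\<in>S. \<bar>cesaro_weight n k - 1\<bar> * norm (a k) * N (\<lambda>t. t powi k))" for n
  proof -
    have eq: "fejer_mean n q t - q t = (\<Sum>k\<in>S. of_real (cesaro_weight n k - 1) * a k * t powi k)"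
      if "norm t = 1" for t
      using that S(2) by (simp add: fejer_mean_trig[OF S] sum_subtractf[symmetric] algebra_simps)
    have "N (\<lambda>t. fejer_mean n q t - q t) = N (\<lambda>t. \<Sum>k\<in>S. of_real (cesaro_weight n k - 1) * a k * t powi k)"
    proof (rule N_cong_AE(2))
      show "(\<lambda>t. \<Sum>k\<in>S. of_real (cesaro_weight n k - 1) * a k * t powi k) \<in> bfs \<rho>"
        by (intro bfs_sum S(1) b(1))
      show "(\<lambda>t. fejer_mean n q t - q t) \<in> L0"
        by (rule bfs_L0[OF bfs_diff(1)[OF trig_bfs[OF fejer_mean_trig_poly] trig_bfs[OF assms]]])
      show "AE t in circle. norm (fejer_mean n q t - q t) =
          norm (\<Sum>k\<in>S. of_real (cesaro_weight n k - 1) * a k * t powi k)"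
        using eq by (intro AE_I2) auto
    qed
    also have "\<dots> \<le> (\<Sum>k\<in>S. N (\<lambda>t. of_real (cesaro_weight n k - 1) * a k * t powi k))"
      by (intro N_sum_le S(1) b(1))
    finally show ?thesis unfolding b(2) norm_mult norm_of_real .
  qed
  have "(\<lambda>n. \<Sum>k\<in>S. \<bar>cesaro_weight n k - 1\<bar> * norm (a k) * N (\<lambda>t. t powi k)) \<longlonglongrightarrow>
    (\<Sum>k\<in>S. \<bar>1 - 1\<bar> * norm (a k) * N (\<lambda>t. t powi k))"
    by (intro tendsto_intros cesaro_weight_tendsto)
  then have "(\<lambda>n. \<Sum>k\<in>S. \<bar>cesaro_weight n k - 1\<bar> * norm (a k) * N (\<lambda>t. t powi k)) \<longlonglongrightarrow> 0"
    by simp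
  then show ?thesis
    by (rule Lim_null_comparison[rotated]) (use le in simp)
qed

text \<open>Three errors of size e / 3. The mean of \<open>f - q\<close> is controlled by
  contractivity, whose constant 1 is uniform in \<open>n\<close>; the bound of
  \<open>fejer_mean_bounded\<close> would not suffice here.\<close>

lemma fejer_mean_tendsto:
  assumes ri: "rearrangement_invariant \<rho>" and sep: "bfs_separable \<rho>" and f: "f \<in> bfs \<rho>"
  shows "(\<lambda>n. N (\<lambda>t. fejer_mean n f t - f t)) \<longlonglongrightarrow> 0"
proof (rule LIMSEQ_I)
  fix e :: real assume e: "e > 0"
  then obtain q where q: "q \<in> trig_polynomials" "N (\<lambda>t. f t - q t) < e / 3"
    using trig_closureE[OF trig_polynomials_dense[OF sep f], of "e / 3"] by auto
  have q': "q \<in> bfs \<rho>" by (rule trig_bfs[OF q(1)])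
  have fm: "fejer_mean n g \<in> bfs \<rho>" for n g by (rule trig_bfs[OF fejer_mean_trig_poly])
  have "\<forall>\<^sub>F n in sequentially. N (\<lambda>t. fejer_mean n q t - q t) < e / 3"
    using e by (intro order_tendstoD(2)[OF fejer_mean_trig_tendsto[OF q(1)]]) auto
  then obtain n0 where n0: "\<And>n. n \<ge> n0 \<Longrightarrow> N (\<lambda>t. fejer_mean n q t - q t) < e / 3"
    unfolding eventually_sequentially by blast
  have "N (\<lambda>t. fejer_mean n f t - f t) < e" if "n \<ge> n0" for n
  proof -
    have "N (\<lambda>t. fejer_mean n f t - f t) \<le> N (\<lambda>t. fejer_mean n f t - fejer_mean n q t) + N (\<lambda>t. fejer_mean n q t - f t)"
      by (rule N_triangle[OF fm fm f])
    also have "N (\<lambda>t. fejer_mean n q t - f t) \<le> N (\<lambda>t. fejer_mean n q t - q t) + N (\<lambda>t. q t - f t)"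
      by (rule N_triangle[OF fm q' f])
    also have "N (\<lambda>t. fejer_mean n f t - fejer_mean n q t) \<le> N (\<lambda>t. f t - q t)"
      using N_fejer_mean_le[OF ri sep bfs_diff(1)[OF f q'], of n] by (simp add: fejer_mean_diff[OF f q', abs_def])
    finally show ?thesis
      using q(2) n0[OF that] N_minus_commute[of q f] by linarith
  qed
  then show "\<exists>no. \<forall>n\<ge>no. norm (N (\<lambda>t. fejer_mean n f t - f t) - 0) < e" by auto
qed

lemma fejer_mean_hardy:
  assumes "f \<in> hardy \<rho>"
  shows "fejer_mean n f \<in> analytic_polynomials"
proof -
  have "fejer_mean n f t = (\<Sum>k\<le>n. (of_real (cesaro_weight n (int k)) * fourier_coeff f (int k)) * t ^ k)" for t
  proof -
    have "fejer_mean n f t = (\<Sum>k\<in>{0..int n}. of_real (cesaro_weight n k) * fourier_coeff f k * t powi k)"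
      unfolding fejer_mean_def using assms
      by (intro sum.mono_neutral_right) (auto simp: hardy_def)
    also have "\<dots> = (\<Sum>k\<le>n. (of_real (cesaro_weight n (int k)) * fourier_coeff f (int k)) * t ^ k)"
      by (rule sum.reindex_bij_witness[of _ int nat]) (auto simp: power_int_def)
    finally show ?thesis .
  qed
  then show ?thesis
    unfolding analytic_polynomials_def
    by (intro CollectI exI[of _ n] exI[of _ "\<lambda>k. of_real (cesaro_weight n (int k)) * fourier_coeff f (int k)"] ext)
qed

text \<open>\<open>bfs_dense_in\<close> asks for inclusion besides approximation; the coefficients
  are read off by orthogonality.\<close>

lemma analytic_polynomials_hardy: "analytic_polynomials \<subseteq> hardy \<rho>"
proof
  fix q assume "q \<in> analytic_polynomials"
  then obtain n \<alpha> where q: "q = (\<lambda>t. \<Sum>k\<le>n. \<alpha> k * t ^ k)"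
    by (auto simp: analytic_polynomials_def)
  have q': "q t = (\<Sum>k\<in>int ` {..n}. \<alpha> (nat k) * t powi k)" for t
    unfolding q by (subst sum.reindex) auto
  have "q \<in> bfs \<rho>" unfolding q by (rule continuous_bfs) (intro continuous_intros)
  moreover have "fourier_coeff q k = 0" if "k < 0" for k
    using that by (subst fourier_coeff_trig[OF _ q']) auto
  ultimately show "q \<in> hardy \<rho>" by (simp add: hardy_def)
qed

end

theorem theorem1p1:
  fixes \<rho> :: "(complex \<Rightarrow> ennreal) \<Rightarrow> ennreal"
  assumes "banach_function_norm \<rho>"
    and "bfs_separable \<rho>"
    and "rearrangement_invariant \<rho>"
  shows "bfs_dense_in \<rho> analytic_polynomials (hardy \<rho>) \<and>
    (\<forall>f\<in>hardy \<rho>. \<exists>p :: nat \<Rightarrow> complex \<Rightarrow> complex.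
       (\<forall>n. p n \<in> analytic_polynomials \<and> bfs_norm \<rho> (p n) \<le> bfs_norm \<rho> f) \<and>
       (\<lambda>n. bfs_norm \<rho> (\<lambda>t. p n t - f t)) \<longlonglongrightarrow> 0)"
proof -
  interpret bf_norm \<rho> by unfold_locales fact
  \<comment> \<open>The Fejer means of \<open>f\<close> serve both claims: density follows from the
    convergence of this one sequence.\<close>
  have main: "(\<forall>n. fejer_mean n f \<in> analytic_polynomials \<and> N (fejer_mean n f) \<le> N f) \<and>
      (\<lambda>n. N (\<lambda>t. fejer_mean n f t - f t)) \<longlonglongrightarrow> 0" if "f \<in> hardy \<rho>" for f
    using that assms fejer_mean_hardy N_fejer_mean_le fejer_mean_tendsto by (simp add: hardy_def)
  have "\<exists>g\<in>analytic_polynomials. N (\<lambda>t. f t - g t) < \<epsilon>" if "f \<in> hardy \<rho>" "\<epsilon> > 0" for f \<epsilon>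
  proof -
    have "\<forall>\<^sub>F n in sequentially. N (\<lambda>t. fejer_mean n f t - f t) < \<epsilon>"
      using main[OF that(1)] that(2) by (intro order_tendstoD(2)[of _ 0]) auto
    then obtain n where "N (\<lambda>t. fejer_mean n f t - f t) < \<epsilon>"
      by (auto simp: eventually_sequentially)
    then show ?thesis
      using main[OF that(1)] by (intro bexI[of _ "fejer_mean n f"]) (auto simp: N_minus_commute[of f])
  qed
  then have "bfs_dense_in \<rho> analytic_polynomials (hardy \<rho>)"
    using analytic_polynomials_hardy by (simp add: bfs_dense_in_def)
  moreover have "\<exists>p. (\<forall>n. p n \<in> analytic_polynomials \<and> N (p n) \<le> N f) \<and>
      (\<lambda>n. N (\<lambda>t. p n t - f t)) \<longlonglongrightarrow> 0" if "f \<in> hardy \<rho>" for f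
    by (rule exI[of _ "\<lambda>n. fejer_mean n f"]) (rule main[OF that])
  ultimately show ?thesis by simp
qed

end
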